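(* Let $\phi$ be a conic totally complex holomorphic immersion of a complex manifold $(M,J)$ into $V=T^*\mathbb{C}^n$, $n=\dim_{\mathbb{C}}M$, let $\nabla$ be the induced connection and $\omega=2\phi^*(\sum_{i=1}^n dx^i\wedge dy_i)$ the induced symplectic form. Then: (i) $(M,J,\nabla,\omega)$ is a conic symplectic manifold. (ii) The pull back via $\phi$ of the functions $(x^1=\mathrm{Re}\,z^1,\dots,x^n=\mathrm{Re}\,z^n,\ y_1=\mathrm{Re}\,w_1,\dots,y_n=\mathrm{Re}\,w_n)$ of $V$ defines a conic real special coordinate system around each point of $M$.
   Context: A local holomorphic $\mathbb{C}^*$-action on a complex manifold $M$ is a holomorphic map $(\lambda,p)\mapsto\varphi_\lambda(p)\in M$ defined on an open neighbourhood $W$ of $\{1\}\times M$ in $\mathbb{C}^*\times M$ such that $\varphi_1(p)=p$ for all $p$ and $\varphi_\lambda(\varphi_\mu(p))=\varphi_{\lambda\mu}(p)$ whenever both sides are defined. Equations involving $\varphi_\lambda$ are meant to hold locally, i.e. on any open set on which $\varphi_\lambda$ is defined and is a diffeomorphism onto its image. A conic complex manifold $(M,J,\nabla)$ is a complex manifold $(M,J)$ with a flat torsionfree connection $\nabla$ (on the real tangent bundle) admitting a local holomorphic $\mathbb{C}^*$-action $\varphi_\lambda$ such that locally $d\varphi_\lambda X=re^{\theta J}X=r(\cos\theta)X+r(\sin\theta)JX$ for all (local) $\nabla$-parallel vector fields $X$, where $\lambda=re^{i\theta}$, $r>0$. A conic symplectic manifold is a conic complex manifold with a $\nabla$-parallel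 symplectic form $\omega$. A real special coordinate system is a local coordinate system $(x^1,\dots,x^n,y_1,\dots,y_n)$ of $\nabla$-affine functions (functions $f$ with $\nabla df=0$) with $\omega=2\sum dx^i\wedge dy_i$. It is called conic if there are local holomorphic functions $(z,w)=(z^1,\dots,z^n,w_1,\dots,w_n)$ with $\mathrm{Re}\,z^i=x^i$, $\mathrm{Re}\,w_j=y_j$ such that locally $(z,w)\circ\varphi_\lambda=\lambda(z,w)$. $V=T^*\mathbb{C}^n=\mathbb{C}^{2n}$ has canonical coordinates $(z^1,\dots,z^n,w_1,\dots,w_n)$ and standard real structure $\tau$ (complex conjugation) with fixed point set $V^\tau=T^*\mathbb{R}^n=\mathbb{R}^{2n}$. A holomorphic immersion $\phi:M\to V$ of a connected complex $n$-fold is totally complex if $V^\tau\cap d\phi(T_pM)=0$ for all $p\in M$; it is conic if for every $p\in M$ and every neighbourhood $U$ of $p$ there exist neighbourhoods $U_1$ of $1\in\mathbb{C}^*$ and $U_p$ of $p$ such that $\lambda\phi(U_p)\subset\phi(U)$ for all $\lambda\in U_1$. If $\phi$ is totally complex, the functions $x^i\circ\phi,\ y_j\circ\phi$ are local coordinates around each point of $M$; the induced connection $\nabla$ is the flat torsionfree connection for which these functions are affine, and the induced symplectic form is $\omega=2\phi^*(\sum dx^i\wedge dy_i)$. *)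

theory Defs
  imports "HOL-Analysis.Analysis"
begin

subsection \<open>Smooth and holomorphic maps between vector spaces\<close>

text \<open>For an open subset of a Euclidean space: all iterated directional derivatives up to
  order k exist as Frechet derivatives and are continuous, i.e. the map is of class C^k.\<close>

primrec Ck_on ::
  "nat \<Rightarrow> 'a::real_normed_vector set \<Rightarrow> ('a \<Rightarrow> 'b::real_normed_vector) \<Rightarrow> bool" where
  "Ck_on 0 S f = continuous_on S f"
| "Ck_on (Suc k) S f =
    ((\<forall>x\<in>S. f differentiable (at x)) \<and> (\<forall>v. Ck_on k S (\<lambda>x. frechet_derivative f (at x) v)))"

definition smooth_on :: "'a::real_normed_vector set \<Rightarrow> ('a \<Rightarrow> 'b::real_normed_vector) \<Rightarrow> bool" where
  "smooth_on S f \<longleftrightarrow> open S \<and> (\<forall>k. Ck_on k S f)"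

text \<open>Holomorphy in several variables: on an open set, a real Frechet derivative exists at every
  point and intertwines the complex structures (multiplications by i) of source and target.\<close>

definition holomorphic_wrt ::
  "('a::real_normed_vector \<Rightarrow> 'a) \<Rightarrow> ('b::real_normed_vector \<Rightarrow> 'b) \<Rightarrow> 'a set \<Rightarrow> ('a \<Rightarrow> 'b) \<Rightarrow> bool"
  where
  "holomorphic_wrt J1 J2 S f \<longleftrightarrow>
     open S \<and> (\<forall>x\<in>S. \<exists>L. (f has_derivative L) (at x) \<and> (\<forall>v. L (J1 v) = J2 (L v)))"

definition J_vec :: "complex^'n \<Rightarrow> complex^'n" where
  "J_vec v = \<i> *s v"

definition J_prod :: "complex \<times> (complex^'n) \<Rightarrow> complex \<times> (complex^'n)" where
  "J_prod = (\<lambda>(l, v). (\<i> * l, \<i> *s v))"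

subsection \<open>The model space V, the cotangent bundle of complex n-space\<close>

text \<open>A point of V is a pair (z, w).\<close>

type_synonym 'n cotangent = "(complex^'n) \<times> (complex^'n)"

definition scale_V :: "complex \<Rightarrow> 'n::finite cotangent \<Rightarrow> 'n cotangent" where
  "scale_V l = (\<lambda>(z, w). (l *s z, l *s w))"

abbreviation J_V :: "'n::finite cotangent \<Rightarrow> 'n cotangent" where
  "J_V \<equiv> scale_V \<i>"

definition tau :: "'n::finite cotangent \<Rightarrow> 'n cotangent" where
  "tau = (\<lambda>(z, w). (\<chi> i. cnj (z $ i), \<chi> i. cnj (w $ i)))"

definition V_tau :: "'n::finite cotangent set" where
  "V_tau = {v. tau v = v}"

definition x_coord :: "'n::finite \<Rightarrow> 'n cotangent \<Rightarrow> real" where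
  "x_coord i v = Re (fst v $ i)"

definition y_coord :: "'n::finite \<Rightarrow> 'n cotangent \<Rightarrow> real" where
  "y_coord i v = Re (snd v $ i)"

text \<open>The constant-coefficient form sum dx^i wedge dy_i on V; dx^i and dy_i are the linear maps
  x^i and y_i on tangent vectors, and (a wedge b)(u,v) = a(u) b(v) - a(v) b(u).\<close>

definition sum_dx_dy :: "'n::finite cotangent \<Rightarrow> 'n cotangent \<Rightarrow> real" where
  "sum_dx_dy u v = (\<Sum>i\<in>UNIV. x_coord i u * y_coord i v - x_coord i v * y_coord i u)"

subsection \<open>Complex manifolds\<close>

text \<open>A chart is its domain together with its coordinate map. The manifold is the whole
  type 'm, with its topology.\<close>

type_synonym ('m, 'n) chart = "'m set \<times> ('m \<Rightarrow> complex^'n)"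

definition chart_inv :: "('m, 'n) chart \<Rightarrow> complex^'n \<Rightarrow> 'm" where
  "chart_inv c = inv_into (fst c) (snd c)"

definition is_chart :: "('m::topological_space, 'n::finite) chart \<Rightarrow> bool" where
  "is_chart c \<longleftrightarrow> open (fst c) \<and> open (snd c ` fst c) \<and>
     homeomorphism (fst c) (snd c ` fst c) (snd c) (chart_inv c)"

definition transition :: "('m, 'n) chart \<Rightarrow> ('m, 'n) chart \<Rightarrow> complex^'n \<Rightarrow> complex^'n" where
  "transition c c' = snd c' \<circ> chart_inv c"

definition complex_atlas :: "('m::topological_space, 'n::finite) chart set \<Rightarrow> bool" where
  "complex_atlas A \<longleftrightarrow> (\<forall>c\<in>A. is_chart c) \<and> (\<Union>c\<in>A. fst c) = UNIV \<and>
     (\<forall>c\<in>A. \<forall>c'\<in>A.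
        holomorphic_wrt J_vec J_vec (snd c ` (fst c \<inter> fst c')) (transition c c'))"

text \<open>Smooth and holomorphic maps from an open subset D of M to a vector space.\<close>

definition smooth_fun ::
  "('m::topological_space, 'n::finite) chart set \<Rightarrow> 'm set \<Rightarrow> ('m \<Rightarrow> 'b::real_normed_vector) \<Rightarrow> bool"
  where
  "smooth_fun A D f \<longleftrightarrow> open D \<and> (\<forall>c\<in>A. smooth_on (snd c ` (D \<inter> fst c)) (f \<circ> chart_inv c))"

definition holomorphic_fun ::
  "('m::topological_space, 'n::finite) chart set \<Rightarrow> 'm set \<Rightarrow> ('m \<Rightarrow> 'k::finite cotangent) \<Rightarrow> bool"
  where
  "holomorphic_fun A D f \<longleftrightarrow>
     open D \<and> (\<forall>c\<in>A. holomorphic_wrt J_vec J_V (snd c ` (D \<inter> fst c)) (f \<circ> chart_inv c))"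

definition smooth_map ::
  "('m::topological_space, 'n::finite) chart set \<Rightarrow> 'm set \<Rightarrow> ('m \<Rightarrow> 'm) \<Rightarrow> bool" where
  "smooth_map A D f \<longleftrightarrow> open D \<and> continuous_on D f \<and>
     (\<forall>c\<in>A. \<forall>c'\<in>A. smooth_on (snd c ` {p \<in> D \<inter> fst c. f p \<in> fst c'}) (snd c' \<circ> f \<circ> chart_inv c))"

definition diffeo_onto_image ::
  "('m::topological_space, 'n::finite) chart set \<Rightarrow> 'm set \<Rightarrow> ('m \<Rightarrow> 'm) \<Rightarrow> bool" where
  "diffeo_onto_image A D f \<longleftrightarrow>
     inj_on f D \<and> smooth_map A D f \<and> smooth_map A (f ` D) (inv_into D f)"

text \<open>The differential at p of a vector-valued function, in terms of the chart c.\<close>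

definition diff_in ::
  "('m, 'n::finite) chart \<Rightarrow> ('m \<Rightarrow> 'b::real_normed_vector) \<Rightarrow> 'm \<Rightarrow> complex^'n \<Rightarrow> 'b" where
  "diff_in c f p = frechet_derivative (f \<circ> chart_inv c) (at (snd c p))"

subsection \<open>Vector fields\<close>

text \<open>Real tangent vectors at p are represented by their components in every chart around p,
  subject to the transformation law; J acts by multiplication by i on the components.\<close>

type_synonym ('m, 'n) field = "('m, 'n) chart \<Rightarrow> 'm \<Rightarrow> complex^'n"

definition vector_field ::
  "('m::topological_space, 'n::finite) chart set \<Rightarrow> 'm set \<Rightarrow> ('m, 'n) field \<Rightarrow> bool" where
  "vector_field A D X \<longleftrightarrow> open D \<and>
     (\<forall>c\<in>A. smooth_on (snd c ` (D \<inter> fst c)) (X c \<circ> chart_inv c)) \<and>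
     (\<forall>c\<in>A. \<forall>c'\<in>A. \<forall>p \<in> D \<inter> fst c \<inter> fst c'. X c' p = diff_in c (snd c') p (X c p))"

definition field_eq ::
  "('m, 'n) chart set \<Rightarrow> 'm set \<Rightarrow> ('m, 'n) field \<Rightarrow> ('m, 'n) field \<Rightarrow> bool" where
  "field_eq A D X Y \<longleftrightarrow> (\<forall>c\<in>A. \<forall>p \<in> D \<inter> fst c. X c p = Y c p)"

definition zero_field :: "('m, 'n::finite) field" where
  "zero_field = (\<lambda>c p. 0)"

definition add_field :: "('m, 'n::finite) field \<Rightarrow> ('m, 'n) field \<Rightarrow> ('m, 'n) field" where
  "add_field X Y = (\<lambda>c p. X c p + Y c p)"

definition diff_field :: "('m, 'n::finite) field \<Rightarrow> ('m, 'n) field \<Rightarrow> ('m, 'n) field" where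
  "diff_field X Y = (\<lambda>c p. X c p - Y c p)"

definition scale_field :: "('m \<Rightarrow> real) \<Rightarrow> ('m, 'n::finite) field \<Rightarrow> ('m, 'n) field" where
  "scale_field f X = (\<lambda>c p. f p *\<^sub>R X c p)"

text \<open>The derivative X f of a real function along X, computed in the chart c (on the domain of c
  the result does not depend on c).\<close>

definition deriv_along ::
  "('m, 'n::finite) chart \<Rightarrow> ('m, 'n) field \<Rightarrow> ('m \<Rightarrow> real) \<Rightarrow> 'm \<Rightarrow> real" where
  "deriv_along c X f p = diff_in c f p (X c p)"

definition lie_bracket ::
  "('m, 'n::finite) field \<Rightarrow> ('m, 'n) field \<Rightarrow> ('m, 'n) field" where
  "lie_bracket X Y = (\<lambda>c p. diff_in c (Y c) p (X c p) - diff_in c (X c) p (Y c p))"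

subsection \<open>Connections on the real tangent bundle\<close>

text \<open>A connection is given by its covariant derivative (X, Y) maps to nabla_X Y, acting on
  vector fields over arbitrary open subsets, compatibly with restriction.\<close>

type_synonym ('m, 'n) conn = "('m, 'n) field \<Rightarrow> ('m, 'n) field \<Rightarrow> ('m, 'n) field"

definition is_connection ::
  "('m::topological_space, 'n::finite) chart set \<Rightarrow> ('m, 'n) conn \<Rightarrow> bool" where
  "is_connection A nabla \<longleftrightarrow>
    (\<forall>D X Y. vector_field A D X \<and> vector_field A D Y \<longrightarrow> vector_field A D (nabla X Y)) \<and>
    (\<forall>D X X' Y Y'. vector_field A D X \<and> vector_field A D X' \<and>
        vector_field A D Y \<and> vector_field A D Y' \<and> field_eq A D X X' \<and> field_eq A D Y Y' \<longrightarrow>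
        field_eq A D (nabla X Y) (nabla X' Y')) \<and>
    (\<forall>D X X' Y. vector_field A D X \<and> vector_field A D X' \<and> vector_field A D Y \<longrightarrow>
        field_eq A D (nabla (add_field X X') Y) (add_field (nabla X Y) (nabla X' Y))) \<and>
    (\<forall>D f X Y. smooth_fun A D f \<and> vector_field A D X \<and> vector_field A D Y \<longrightarrow>
        field_eq A D (nabla (scale_field f X) Y) (scale_field f (nabla X Y))) \<and>
    (\<forall>D X Y Y'. vector_field A D X \<and> vector_field A D Y \<and> vector_field A D Y' \<longrightarrow>
        field_eq A D (nabla X (add_field Y Y')) (add_field (nabla X Y) (nabla X Y'))) \<and>
    (\<forall>D f X Y. smooth_fun A D f \<and> vector_field A D X \<and> vector_field A D Y \<longrightarrow>
        field_eq A D (nabla X (scale_field f Y))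
          (\<lambda>c p. deriv_along c X f p *\<^sub>R Y c p + f p *\<^sub>R nabla X Y c p))"

definition torsionfree ::
  "('m::topological_space, 'n::finite) chart set \<Rightarrow> ('m, 'n) conn \<Rightarrow> bool" where
  "torsionfree A nabla \<longleftrightarrow>
    (\<forall>D X Y. vector_field A D X \<and> vector_field A D Y \<longrightarrow>
       field_eq A D (diff_field (diff_field (nabla X Y) (nabla Y X)) (lie_bracket X Y)) zero_field)"

definition flat ::
  "('m::topological_space, 'n::finite) chart set \<Rightarrow> ('m, 'n) conn \<Rightarrow> bool" where
  "flat A nabla \<longleftrightarrow>
    (\<forall>D X Y Z. vector_field A D X \<and> vector_field A D Y \<and> vector_field A D Z \<longrightarrow>
       field_eq A D
         (diff_field (diff_field (nabla X (nabla Y Z)) (nabla Y (nabla X Z)))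
                     (nabla (lie_bracket X Y) Z))
         zero_field)"

definition flat_torsionfree_connection ::
  "('m::topological_space, 'n::finite) chart set \<Rightarrow> ('m, 'n) conn \<Rightarrow> bool" where
  "flat_torsionfree_connection A nabla \<longleftrightarrow>
     is_connection A nabla \<and> flat A nabla \<and> torsionfree A nabla"

text \<open>The condition nabla df = 0 on D, using (nabla_X df)(Y) = X(Y f) - (nabla_X Y) f.\<close>

definition affine_fun ::
  "('m::topological_space, 'n::finite) chart set \<Rightarrow> ('m, 'n) conn \<Rightarrow> 'm set \<Rightarrow> ('m \<Rightarrow> real) \<Rightarrow> bool"
  where
  "affine_fun A nabla D f \<longleftrightarrow> smooth_fun A D f \<and>
    (\<forall>E X Y. E \<subseteq> D \<and> vector_field A E X \<and> vector_field A E Y \<longrightarrow>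
       (\<forall>c\<in>A. \<forall>p \<in> E \<inter> fst c.
          deriv_along c X (deriv_along c Y f) p - deriv_along c (nabla X Y) f p = 0))"

definition parallel_field ::
  "('m::topological_space, 'n::finite) chart set \<Rightarrow> ('m, 'n) conn \<Rightarrow> 'm set \<Rightarrow> ('m, 'n) field \<Rightarrow> bool"
  where
  "parallel_field A nabla D X \<longleftrightarrow> vector_field A D X \<and>
    (\<forall>E Y. E \<subseteq> D \<and> vector_field A E Y \<longrightarrow> field_eq A E (nabla Y X) zero_field)"

subsection \<open>Symplectic forms\<close>

text \<open>Two-forms are represented by their components in every chart, like vector fields.\<close>

type_synonym ('m, 'n) form2 = "('m, 'n) chart \<Rightarrow> 'm \<Rightarrow> complex^'n \<Rightarrow> complex^'n \<Rightarrow> real"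

definition two_form ::
  "('m::topological_space, 'n::finite) chart set \<Rightarrow> ('m, 'n) form2 \<Rightarrow> bool" where
  "two_form A om \<longleftrightarrow>
    (\<forall>c\<in>A. \<forall>p\<in>fst c. (\<forall>u. linear (om c p u)) \<and> (\<forall>v. linear (\<lambda>u. om c p u v)) \<and>
       (\<forall>u v. om c p u v = - om c p v u)) \<and>
    (\<forall>c\<in>A. \<forall>u v. smooth_on (snd c ` fst c) (\<lambda>x. om c (chart_inv c x) u v)) \<and>
    (\<forall>c\<in>A. \<forall>c'\<in>A. \<forall>p \<in> fst c \<inter> fst c'. \<forall>u v.
       om c p u v = om c' p (diff_in c (snd c') p u) (diff_in c (snd c') p v))"

definition closed_form :: "('m, 'n::finite) chart set \<Rightarrow> ('m, 'n) form2 \<Rightarrow> bool" where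
  "closed_form A om \<longleftrightarrow> (\<forall>c\<in>A. \<forall>p\<in>fst c. \<forall>u v w.
     diff_in c (\<lambda>q. om c q v w) p u - diff_in c (\<lambda>q. om c q u w) p v
       + diff_in c (\<lambda>q. om c q u v) p w = 0)"

definition symplectic_form ::
  "('m::topological_space, 'n::finite) chart set \<Rightarrow> ('m, 'n) form2 \<Rightarrow> bool" where
  "symplectic_form A om \<longleftrightarrow> two_form A om \<and> closed_form A om \<and>
    (\<forall>c\<in>A. \<forall>p\<in>fst c. \<forall>u. (\<forall>v. om c p u v = 0) \<longrightarrow> u = 0)"

text \<open>(nabla_Z om)(X,Y) = Z(om(X,Y)) - om(nabla_Z X, Y) - om(X, nabla_Z Y).\<close>

definition parallel_form ::
  "('m::topological_space, 'n::finite) chart set \<Rightarrow> ('m, 'n) conn \<Rightarrow> ('m, 'n) form2 \<Rightarrow> bool" where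
  "parallel_form A nabla om \<longleftrightarrow>
    (\<forall>D X Y Z. vector_field A D X \<and> vector_field A D Y \<and> vector_field A D Z \<longrightarrow>
      (\<forall>c\<in>A. \<forall>p \<in> D \<inter> fst c.
         deriv_along c Z (\<lambda>q. om c q (X c q) (Y c q)) p
           - om c p (nabla Z X c p) (Y c p) - om c p (X c p) (nabla Z Y c p) = 0))"

subsection \<open>Local actions and conic manifolds\<close>

definition local_holomorphic_action ::
  "('m::topological_space, 'n::finite) chart set \<Rightarrow> (complex \<times> 'm) set \<Rightarrow>
     (complex \<Rightarrow> 'm \<Rightarrow> 'm) \<Rightarrow> bool" where
  "local_holomorphic_action A W \<Phi> \<longleftrightarrow>
     open W \<and> W \<subseteq> (- {0}) \<times> UNIV \<and> {1} \<times> UNIV \<subseteq> W \<and>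
     continuous_on W (\<lambda>(l, p). \<Phi> l p) \<and>
     (\<forall>c\<in>A. \<forall>c'\<in>A.
        holomorphic_wrt J_prod J_vec
          {(l, x). x \<in> snd c ` fst c \<and> (l, chart_inv c x) \<in> W \<and> \<Phi> l (chart_inv c x) \<in> fst c'}
          (\<lambda>(l, x). snd c' (\<Phi> l (chart_inv c x)))) \<and>
     (\<forall>p. \<Phi> 1 p = p) \<and>
     (\<forall>l m p. (m, p) \<in> W \<and> (l, \<Phi> m p) \<in> W \<and> (l * m, p) \<in> W \<longrightarrow>
        \<Phi> l (\<Phi> m p) = \<Phi> (l * m) p)"

text \<open>Open sets on which the transformation with parameter l is defined and is a diffeomorphism
  onto its image; equations between local transformations are required on all such sets.\<close>

definition action_domain ::
  "('m::topological_space, 'n::finite) chart set \<Rightarrow> (complex \<times> 'm) set \<Rightarrow>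
     (complex \<Rightarrow> 'm \<Rightarrow> 'm) \<Rightarrow> complex \<Rightarrow> 'm set \<Rightarrow> bool" where
  "action_domain A W \<Phi> l B \<longleftrightarrow> open B \<and> {l} \<times> B \<subseteq> W \<and> diffeo_onto_image A B (\<Phi> l)"

text \<open>The parallel field X compared at p and at its image under the transformation is defined
  on a connected open set containing both points: over a disconnected set it could be altered
  independently near the two points.\<close>

definition conic_action ::
  "('m::topological_space, 'n::finite) chart set \<Rightarrow> ('m, 'n) conn \<Rightarrow> (complex \<times> 'm) set \<Rightarrow>
     (complex \<Rightarrow> 'm \<Rightarrow> 'm) \<Rightarrow> bool" where
  "conic_action A nabla W \<Phi> \<longleftrightarrow>
    (\<forall>r \<theta> B D X. r > 0 \<and> action_domain A W \<Phi> (of_real r * cis \<theta>) B \<and>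
        connected D \<and> parallel_field A nabla D X \<longrightarrow>
      (\<forall>c\<in>A. \<forall>c'\<in>A. \<forall>p \<in> B \<inter> D \<inter> fst c.
         let q = \<Phi> (of_real r * cis \<theta>) p in
         q \<in> D \<inter> fst c' \<longrightarrow>
         diff_in c (snd c' \<circ> \<Phi> (of_real r * cis \<theta>)) p (X c p)
           = (r * cos \<theta>) *\<^sub>R X c' q + (r * sin \<theta>) *\<^sub>R J_vec (X c' q)))"

definition conic_complex_structure ::
  "('m::topological_space, 'n::finite) chart set \<Rightarrow> ('m, 'n) conn \<Rightarrow> (complex \<times> 'm) set \<Rightarrow>
     (complex \<Rightarrow> 'm \<Rightarrow> 'm) \<Rightarrow> bool" where
  "conic_complex_structure A nabla W \<Phi> \<longleftrightarrow> complex_atlas A \<and>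
     flat_torsionfree_connection A nabla \<and> local_holomorphic_action A W \<Phi> \<and>
     conic_action A nabla W \<Phi>"

definition conic_symplectic_structure ::
  "('m::topological_space, 'n::finite) chart set \<Rightarrow> ('m, 'n) conn \<Rightarrow> ('m, 'n) form2 \<Rightarrow>
     (complex \<times> 'm) set \<Rightarrow> (complex \<Rightarrow> 'm \<Rightarrow> 'm) \<Rightarrow> bool" where
  "conic_symplectic_structure A nabla om W \<Phi> \<longleftrightarrow>
     conic_complex_structure A nabla W \<Phi> \<and> symplectic_form A om \<and> parallel_form A nabla om"

definition conic_symplectic_manifold ::
  "('m::topological_space, 'n::finite) chart set \<Rightarrow> ('m, 'n) conn \<Rightarrow> ('m, 'n) form2 \<Rightarrow> bool" where
  "conic_symplectic_manifold A nabla om \<longleftrightarrow>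
     (\<exists>W \<Phi>. conic_symplectic_structure A nabla om W \<Phi>)"

subsection \<open>Conic real special coordinates\<close>

definition real_coordinates ::
  "('m::topological_space, 'n::finite) chart set \<Rightarrow> 'm set \<Rightarrow> ('m \<Rightarrow> (real^'n) \<times> (real^'n)) \<Rightarrow> bool"
  where
  "real_coordinates A D F \<longleftrightarrow>
     open D \<and> open (F ` D) \<and> homeomorphism D (F ` D) F (inv_into D F) \<and> smooth_fun A D F \<and>
     (\<forall>c\<in>A. smooth_on (F ` (D \<inter> fst c)) (snd c \<circ> inv_into D F))"

definition real_special_coordinates ::
  "('m::topological_space, 'n::finite) chart set \<Rightarrow> ('m, 'n) conn \<Rightarrow> ('m, 'n) form2 \<Rightarrow> 'm set \<Rightarrow>
     ('n \<Rightarrow> 'm \<Rightarrow> real) \<Rightarrow> ('n \<Rightarrow> 'm \<Rightarrow> real) \<Rightarrow> bool" where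
  "real_special_coordinates A nabla om D x y \<longleftrightarrow>
     real_coordinates A D (\<lambda>p. (\<chi> i. x i p, \<chi> i. y i p)) \<and>
     (\<forall>i. affine_fun A nabla D (x i) \<and> affine_fun A nabla D (y i)) \<and>
     (\<forall>c\<in>A. \<forall>p \<in> D \<inter> fst c. \<forall>u v.
        om c p u v = 2 * (\<Sum>i\<in>UNIV. diff_in c (x i) p u * diff_in c (y i) p v
                                   - diff_in c (x i) p v * diff_in c (y i) p u))"

definition conic_real_special_coordinates ::
  "('m::topological_space, 'n::finite) chart set \<Rightarrow> ('m, 'n) conn \<Rightarrow> ('m, 'n) form2 \<Rightarrow>
     (complex \<times> 'm) set \<Rightarrow> (complex \<Rightarrow> 'm \<Rightarrow> 'm) \<Rightarrow> 'm set \<Rightarrow>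
     ('n \<Rightarrow> 'm \<Rightarrow> real) \<Rightarrow> ('n \<Rightarrow> 'm \<Rightarrow> real) \<Rightarrow> bool" where
  "conic_real_special_coordinates A nabla om W \<Phi> D x y \<longleftrightarrow>
     real_special_coordinates A nabla om D x y \<and>
     (\<exists>zw :: 'm \<Rightarrow> 'n cotangent. holomorphic_fun A D zw \<and>
        (\<forall>p\<in>D. \<forall>i. Re (fst (zw p) $ i) = x i p \<and> Re (snd (zw p) $ i) = y i p) \<and>
        (\<forall>l B. action_domain A W \<Phi> l B \<longrightarrow>
           (\<forall>p \<in> B \<inter> D. \<Phi> l p \<in> D \<longrightarrow> zw (\<Phi> l p) = scale_V l (zw p))))"

subsection \<open>Totally complex conic immersions\<close>

definition holomorphic_immersion ::
  "('m::topological_space, 'n::finite) chart set \<Rightarrow> ('m \<Rightarrow> 'n cotangent) \<Rightarrow> bool" where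
  "holomorphic_immersion A \<phi> \<longleftrightarrow>
     holomorphic_fun A UNIV \<phi> \<and> (\<forall>c\<in>A. \<forall>p\<in>fst c. inj (diff_in c \<phi> p))"

definition totally_complex ::
  "('m::topological_space, 'n::finite) chart set \<Rightarrow> ('m \<Rightarrow> 'n cotangent) \<Rightarrow> bool" where
  "totally_complex A \<phi> \<longleftrightarrow> connected (UNIV :: 'm set) \<and> holomorphic_immersion A \<phi> \<and>
     (\<forall>c\<in>A. \<forall>p\<in>fst c. V_tau \<inter> range (diff_in c \<phi> p) = {0})"

definition conic_immersion :: "('m::topological_space \<Rightarrow> 'n::finite cotangent) \<Rightarrow> bool" where
  "conic_immersion \<phi> \<longleftrightarrow>
    (\<forall>p U. open U \<and> p \<in> U \<longrightarrow>
      (\<exists>U1 Up. open U1 \<and> 1 \<in> U1 \<and> 0 \<notin> U1 \<and> open Up \<and> p \<in> Up \<and>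
         (\<forall>l\<in>U1. scale_V l ` \<phi> ` Up \<subseteq> \<phi> ` U)))"

definition induced_connection ::
  "('m::topological_space, 'n::finite) chart set \<Rightarrow> ('m \<Rightarrow> 'n cotangent) \<Rightarrow> ('m, 'n) conn \<Rightarrow> bool"
  where
  "induced_connection A \<phi> nabla \<longleftrightarrow> flat_torsionfree_connection A nabla \<and>
     (\<forall>i. affine_fun A nabla UNIV (x_coord i \<circ> \<phi>) \<and> affine_fun A nabla UNIV (y_coord i \<circ> \<phi>))"

definition induced_form :: "('m \<Rightarrow> 'n::finite cotangent) \<Rightarrow> ('m, 'n) form2" where
  "induced_form \<phi> = (\<lambda>c p u v. 2 * sum_dx_dy (diff_in c \<phi> p u) (diff_in c \<phi> p v))"

end

theory Submission
  imports Defs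
begin

text \<open>Since the immersion is totally complex, its real part F is injective on tangent spaces and hence a
  local diffeomorphism onto real 2n-space; F is smooth because its components are affine for the
  induced connection. Smoothness of the chart transitions, of constant vector fields and of the
  inverse coordinates follows by differentiating the implicit equation satisfied by a lift through F.
  The action is obtained by lifting scalar multiplication through the immersion: near each point
  this is possible for scalars in a small disc around 1 by the conic condition, and all such local
  lifts agree because discs are convex and lifts of segments are unique (the manifold is Hausdorff
  and the immersion locally injective). If q is the image of p under the action of l, then the
  differential of the immersion at q takes the image of the tangent space at p to l times its image
  at p, so both tangent spaces have the same image, on which a vector is determined by its real
  part; since the real part of a parallel field is constant, parallel fields are multiplied by l.
  The induced form is parallel since its coefficients in affine coordinates are constant, and it is
  closed because torsion-freeness makes second derivatives of affine functions symmetric.\<close>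

subsection \<open>Functions of class C^k\<close>

text \<open>Applying \<open>L\<close> to the difference of the two first-order expansions isolates
  the increment of \<open>h\<close>. The remainder of \<open>G\<close> is small relative to that
  same increment, so it is first absorbed into a Lipschitz bound for \<open>h\<close> at
  \<open>x\<close>.\<close>

lemma has_derivative_lift:
  fixes h :: "'a::real_normed_vector \<Rightarrow> 'e::real_normed_vector"
    and G :: "'e \<Rightarrow> 'f::real_normed_vector"
  assumes G: "(G has_derivative G') (at (h x))"
    and L: "bounded_linear L" "\<And>v. L (G' v) = v"
    and K: "(K has_derivative K') (at x)"
    and h: "isCont h x"
    and eq: "\<forall>\<^sub>F y in nhds x. G (h y) = K y"
  shows "(h has_derivative (\<lambda>v. L (K' v))) (at x)"
  unfolding has_derivative_at_alt
proof (intro conjI allI impI)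
  interpret L: bounded_linear L by fact
  interpret K': bounded_linear K' using K by (rule has_derivative_bounded_linear)
  show "bounded_linear (\<lambda>v. L (K' v))"
    by (rule bounded_linear_compose[OF L(1) K'.bounded_linear_axioms])
  obtain B where B: "B > 0" "\<And>v. norm (L v) \<le> norm v * B"
    using L.pos_bounded by blast
  obtain C where C: "C > 0" "\<And>v. norm (K' v) \<le> norm v * C"
    using K'.pos_bounded by blast
  fix e :: real assume e: "e > 0"
  \<comment> \<open>\<open>e1\<close> controls the remainder of \<open>K\<close> and
    \<open>e2\<close> that of \<open>G\<close>. The bound \<open>1 / (2 * B)\<close> lets the
    increment of \<open>h\<close> be absorbed; the other bound on \<open>e2\<close> makes the term
    estimated through the Lipschitz constant \<open>2 * B * (C + 1)\<close> at most half of the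
    allowed error.\<close>
  define e1 where "e1 = min 1 (e / (2 * B))"
  define e2 where "e2 = min (1 / (2 * B)) (e / (4 * B * B * (C + 1)))"
  have e12: "e1 > 0" "e2 > 0" "e1 \<le> 1" "B * e1 \<le> e / 2" "B * e2 \<le> 1 / 2" "e2 * (4 * B * B * (C + 1)) \<le> e"
  proof -
    have N: "4 * B * B * (C + 1) > 0" using B(1) C(1) by simp
    show "e1 > 0" "e2 > 0" "e1 \<le> 1" using e B(1) N by (auto simp: e1_def e2_def)
    show "B * e1 \<le> e / 2" using B(1) by (auto simp: e1_def min_def field_simps)
    show "B * e2 \<le> 1 / 2" using B(1) by (auto simp: e2_def min_def field_simps)
    have "e2 \<le> e / (4 * B * B * (C + 1))" unfolding e2_def by simp
    then show "e2 * (4 * B * B * (C + 1)) \<le> e" using N by (simp only: pos_le_divide_eq)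
  qed
  obtain d1 where d1: "d1 > 0"
    "\<And>y. norm (y - x) < d1 \<Longrightarrow> norm (K y - K x - K' (y - x)) \<le> e1 * norm (y - x)"
    using K e12(1) unfolding has_derivative_at_alt by blast
  obtain d2 where d2: "d2 > 0"
    "\<And>z. norm (z - h x) < d2 \<Longrightarrow> norm (G z - G (h x) - G' (z - h x)) \<le> e2 * norm (z - h x)"
    using G e12(2) unfolding has_derivative_at_alt by blast
  obtain d3 where d3: "d3 > 0" "\<And>y. norm (y - x) < d3 \<Longrightarrow> norm (h y - h x) < d2"
    using h d2(1) unfolding continuous_at_eps_delta dist_norm by blast
  obtain d4 where d4: "d4 > 0" "\<And>y. norm (y - x) < d4 \<Longrightarrow> G (h y) = K y"
    using eq unfolding eventually_nhds_metric dist_norm by blast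
  show "\<exists>d>0. \<forall>y. norm (y - x) < d \<longrightarrow> norm (h y - h x - L (K' (y - x))) \<le> e * norm (y - x)"
  proof (intro exI[of _ "min d1 (min d3 d4)"] conjI allI impI)
    fix y assume y: "norm (y - x) < min d1 (min d3 d4)"
    let ?a = "norm (y - x)" and ?d = "norm (h y - h x)"
    have K1: "norm (K y - K x - K' (y - x)) \<le> e1 * ?a" using d1 y by auto
    have G1: "norm (G (h y) - G (h x) - G' (h y - h x)) \<le> e2 * ?d" using d2 d3 y by auto
    have eqs: "G (h y) = K y" "G (h x) = K x" using d4 y d4(2)[of x] by auto
    \<comment> \<open>\<open>L\<close> undoes \<open>G'\<close>, and the values of \<open>G\<close>
      along \<open>h\<close> cancel against those of \<open>K\<close>, so only the two remainders
      survive.\<close>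
    have "h y - h x - L (K' (y - x)) =
        L ((K y - K x - K' (y - x)) - (G (h y) - G (h x) - G' (h y - h x)))"
      by (simp add: L.diff L(2) eqs)
    also have "norm \<dots> \<le> norm ((K y - K x - K' (y - x)) - (G (h y) - G (h x) - G' (h y - h x))) * B"
      by (rule B)
    also have "\<dots> \<le> (e1 * ?a + e2 * ?d) * B"
      using B(1) order_trans[OF norm_triangle_ineq4 add_mono[OF K1 G1]] by (intro mult_right_mono) auto
    finally have 1: "norm (h y - h x - L (K' (y - x))) \<le> (B * e1) * ?a + (B * e2) * ?d"
      by (simp add: algebra_simps)
    \<comment> \<open>The increment \<open>?d\<close> occurs on both sides, on the right with a
      factor of at most one half; solving for it gives the Lipschitz bound.\<close>
    have "?d \<le> norm (L (K' (y - x))) + ((B * e1) * ?a + (B * e2) * ?d)"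
      using 1 norm_triangle_ineq2[of "h y - h x" "L (K' (y - x))"] by simp
    moreover have "norm (L (K' (y - x))) \<le> (?a * C) * B"
      using B(2)[of "K' (y - x)"] C(2)[of "y - x"] B(1)
      by (meson less_imp_le mult_right_mono order_trans)
    moreover have "(B * e2) * ?d \<le> 1 / 2 * ?d"
      by (rule mult_right_mono) (use e12 in auto)
    moreover have "(B * e1) * ?a \<le> B * ?a"
      using B(1) e12 by (intro mult_right_mono) auto
    ultimately have "?d \<le> 2 * B * (C + 1) * ?a" by (simp add: algebra_simps)
    then have "(B * e2) * ?d \<le> (B * e2) * (2 * B * (C + 1) * ?a)"
      using B(1) e12 by (intro mult_left_mono) auto
    also have "\<dots> = (e2 * (4 * B * B * (C + 1))) / 2 * ?a" by (simp add: algebra_simps)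
    also have "\<dots> \<le> e / 2 * ?a"
      by (rule mult_right_mono[OF divide_right_mono[OF e12(6)]]) auto
    finally have "(B * e2) * ?d \<le> e / 2 * ?a" .
    moreover have "(B * e1) * ?a \<le> e / 2 * ?a"
      by (rule mult_right_mono) (use e12 in auto)
    ultimately show "norm (h y - h x - L (K' (y - x))) \<le> e * ?a"
      using 1 by (simp add: algebra_simps)
  qed (use d1 d3 d4 in auto)
qed

section \<open>Closure properties of C^k maps\<close>

lemma Ck_on_subset: "Ck_on k S f \<Longrightarrow> T \<subseteq> S \<Longrightarrow> Ck_on k T f"
  by (induction k arbitrary: f) (auto intro: continuous_on_subset)

lemma Ck_on_cong:
  assumes "open S" "\<And>x. x \<in> S \<Longrightarrow> f x = g x" "Ck_on k S f"
  shows "Ck_on k S g"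
  using assms(2,3)
proof (induction k arbitrary: f g)
  case 0
  then show ?case by (simp cong: continuous_on_cong)
next
  case (Suc k)
  have "g differentiable (at x)" if "x \<in> S" for x
    using Suc.prems that assms(1)
    by (metis (mono_tags, lifting) Ck_on.simps(2) differentiable_def has_derivative_transform_within_open)
  moreover have "Ck_on k S (\<lambda>x. frechet_derivative g (at x) v)" for v
  proof (rule Suc.IH)
    show "Ck_on k S (\<lambda>x. frechet_derivative f (at x) v)" using Suc.prems by simp
    fix x assume "x \<in> S"
    then have "frechet_derivative f (at x) = frechet_derivative g (at x)"
      using Suc.prems assms(1) by (intro frechet_derivative_transform_within_open) auto
    then show "frechet_derivative f (at x) v = frechet_derivative g (at x) v" by simp
  qed
  ultimately show ?case by simp
qed

text \<open>Allows an explicit formula in place of \<open>frechet_derivative\<close>, so that sum,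
  product and chain rule can drive the inductions on \<open>k\<close>.\<close>

lemma Ck_on_SucI:
  assumes "open S" "\<And>x. x \<in> S \<Longrightarrow> (f has_derivative f' x) (at x)"
    and "\<And>v. Ck_on k S (\<lambda>x. f' x v)"
  shows "Ck_on (Suc k) S f"
proof -
  have "Ck_on k S (\<lambda>x. frechet_derivative f (at x) v)" for v
    using assms by (intro Ck_on_cong[OF assms(1) _ assms(3)[of v]]) (metis frechet_derivative_at)
  then show ?thesis using assms(2) by (auto simp: differentiable_def)
qed

lemma Ck_on_has_derivative:
  "Ck_on (Suc k) S f \<Longrightarrow> x \<in> S \<Longrightarrow> (f has_derivative frechet_derivative f (at x)) (at x)"
  by (simp add: frechet_derivative_works[symmetric])

lemma Ck_on_imp_continuous_on: "Ck_on k S f \<Longrightarrow> continuous_on S f"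
  by (cases k)
    (auto intro!: continuous_at_imp_continuous_on differentiable_imp_continuous_within)

lemma Ck_on_lower: "Ck_on (Suc k) S f \<Longrightarrow> Ck_on k S f"
proof (induction k arbitrary: f)
  case 0
  then show ?case using Ck_on_imp_continuous_on by (metis Ck_on.simps(1))
next
  case (Suc k)
  then show ?case by (metis Ck_on.simps(2))
qed

lemma Ck_on_const: "open S \<Longrightarrow> Ck_on k S (\<lambda>x. c)"
proof (induction k arbitrary: c)
  case (Suc k)
  then show ?case by (intro Ck_on_SucI[where f' = "\<lambda>x v. 0"]) auto
qed simp

lemma Ck_on_bounded_linear:
  assumes "open S" "bounded_linear L" "Ck_on k S f"
  shows "Ck_on k S (\<lambda>x. L (f x))"
  using assms(3)
proof (induction k arbitrary: f)
  case 0
  then show ?case using assms(2) by (auto intro: bounded_linear.continuous_on)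
next
  case (Suc k)
  show ?case
  proof (rule Ck_on_SucI[OF assms(1)])
    show "((\<lambda>x. L (f x)) has_derivative (\<lambda>v. L (frechet_derivative f (at x) v))) (at x)" if "x \<in> S" for x
      using Ck_on_has_derivative[OF Suc.prems that] assms(2) by (rule bounded_linear.has_derivative[rotated])
  qed (use Suc in auto)
qed

lemma Ck_on_add:
  assumes "open S" "Ck_on k S f" "Ck_on k S g"
  shows "Ck_on k S (\<lambda>x. f x + g x)"
  using assms(2,3)
proof (induction k arbitrary: f g)
  case 0
  then show ?case by (auto intro: continuous_on_add)
next
  case (Suc k)
  note d = Suc.prems[THEN Ck_on_has_derivative]
  show ?case
    by (rule Ck_on_SucI[OF assms(1) has_derivative_add[OF d]]) (use Suc in auto)
qed

lemma Ck_on_sum: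
  assumes "open S" "\<And>i. i \<in> I \<Longrightarrow> Ck_on k S (f i)"
  shows "Ck_on k S (\<lambda>x. \<Sum>i\<in>I. f i x)"
  using assms(2)
  by (induction I rule: infinite_finite_induct) (auto intro: Ck_on_const Ck_on_add assms(1))

lemma Ck_on_scaleR:
  assumes "open S" "Ck_on k S a" "Ck_on k S f"
  shows "Ck_on k S (\<lambda>x. a x *\<^sub>R f x)"
  using assms(2,3)
proof (induction k arbitrary: a f)
  case 0
  then show ?case by (auto intro: continuous_on_scaleR)
next
  case (Suc k)
  note d = Suc.prems[THEN Ck_on_has_derivative]
  have "Ck_on k S a" "Ck_on k S f" using Suc.prems Ck_on_lower by blast+
  then show ?case
    by (intro Ck_on_SucI[OF assms(1) has_derivative_scaleR[OF d]] Ck_on_add assms(1))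
      (use Suc in auto)
qed

lemma linear_basis_expansion:
  fixes f :: "'e::euclidean_space \<Rightarrow> 'b::real_vector"
  assumes "linear f"
  shows "f v = (\<Sum>j\<in>Basis. (v \<bullet> j) *\<^sub>R f j)"
  using assms by (metis (no_types, lifting) euclidean_representation linear_sum linear_cmul sum.cong)

text \<open>Expanding \<open>u x\<close> in a basis turns \<open>A x (u x)\<close> into a finite sum
  of products, so regularity of a family of linear maps is needed only at fixed vectors and no norm
  on linear maps enters.\<close>

lemma Ck_on_linear_family:
  fixes A :: "'a::real_normed_vector \<Rightarrow> 'e::euclidean_space \<Rightarrow> 'b::real_normed_vector"
  assumes S: "open S" and A: "\<And>x. x \<in> S \<Longrightarrow> linear (A x)"
    "\<And>e. Ck_on k S (\<lambda>x. A x e)" and u: "Ck_on k S u"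
  shows "Ck_on k S (\<lambda>x. A x (u x))"
proof (rule Ck_on_cong[OF S])
  show "Ck_on k S (\<lambda>x. \<Sum>j\<in>Basis. (u x \<bullet> j) *\<^sub>R A x j)"
    by (intro Ck_on_sum Ck_on_scaleR A S Ck_on_bounded_linear[OF S _ u, of "\<lambda>v. v \<bullet> _"]
        bounded_linear_inner_left)
qed (use A linear_basis_expansion in metis)

text \<open>By the chain rule the derivative is a linear family, the derivative of \<open>f\<close>
  at \<open>g x\<close>, applied to a vector varying with \<open>x\<close>. The induction varies
  \<open>f\<close> only, since the family consists of directional derivatives of \<open>f\<close>
  composed with the same \<open>g\<close>.\<close>

lemma Ck_on_compose:
  fixes g :: "'a::real_normed_vector \<Rightarrow> 'e::euclidean_space"
  assumes S: "open S" and T: "open T" and g: "g ` S \<subseteq> T"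
  shows "Ck_on k T f \<Longrightarrow> Ck_on k S g \<Longrightarrow> Ck_on k S (\<lambda>x. f (g x))"
proof (induction k arbitrary: f)
  case 0
  then show ?case using g by (auto intro: continuous_on_compose2)
next
  case (Suc k)
  note df = Ck_on_has_derivative[OF Suc.prems(1)] and dg = Ck_on_has_derivative[OF Suc.prems(2)]
  show ?case
  proof (rule Ck_on_SucI[OF S])
    fix x assume "x \<in> S"
    then show "((\<lambda>x. f (g x)) has_derivative
        (\<lambda>v. frechet_derivative f (at (g x)) (frechet_derivative g (at x) v))) (at x)"
      using has_derivative_compose[OF dg df] g by auto
  next
    fix v
    show "Ck_on k S (\<lambda>x. frechet_derivative f (at (g x)) (frechet_derivative g (at x) v))"
    proof (rule Ck_on_linear_family[OF S])
      show "linear (frechet_derivative f (at (g x)))" if "x \<in> S" for x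
        using df[of "g x"] g that has_derivative_linear by blast
      show "Ck_on k S (\<lambda>x. frechet_derivative f (at (g x)) e)" for e
        using Suc.IH[of "\<lambda>y. frechet_derivative f (at y) e"] Suc.prems Ck_on_lower by (simp, blast)
    qed (use Suc.prems in simp)
  qed
qed

section \<open>Linear equations with varying injective coefficients\<close>

lemma linear_norm_le:
  fixes f :: "'e::euclidean_space \<Rightarrow> 'b::real_normed_vector"
  assumes "linear f"
  shows "norm (f v) \<le> (\<Sum>j\<in>Basis. norm (f j)) * norm v"
proof -
  have "norm (f v) \<le> (\<Sum>j\<in>Basis. norm ((v \<bullet> j) *\<^sub>R f j))"
    unfolding linear_basis_expansion[OF assms, of v] by (rule norm_sum)
  also have "\<dots> \<le> (\<Sum>j\<in>Basis. norm v * norm (f j))"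
    by (intro sum_mono) (auto intro!: mult_right_mono simp: Basis_le_norm)
  finally show ?thesis by (simp add: sum_distrib_left mult.commute)
qed

text \<open>Injectivity bounds \<open>A x0\<close> below by a constant \<open>B\<close>. Subtracting
  the equations at \<open>x\<close> and \<open>x0\<close> bounds
  \<open>B * norm (u x - u x0)\<close> by the increment of \<open>w\<close> plus the effect of
  \<open>A x - A x0\<close> on \<open>u x\<close>. No bound on \<open>u x\<close> is known in
  advance, so it is split at \<open>u x0\<close>.\<close>

lemma linear_family_continuous_solution:
  fixes A :: "'a::real_normed_vector \<Rightarrow> 'e::euclidean_space \<Rightarrow> 'b::euclidean_space"
  assumes S: "open S" and A: "\<And>x. x \<in> S \<Longrightarrow> linear (A x)" "\<And>e. continuous_on S (\<lambda>x. A x e)"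
    and inj: "\<And>x. x \<in> S \<Longrightarrow> inj (A x)"
    and w: "continuous_on S w" and eq: "\<And>x. x \<in> S \<Longrightarrow> A x (u x) = w x"
  shows "continuous_on S u"
proof (rule continuous_at_imp_continuous_on, rule ballI)
  fix x0 assume x0: "x0 \<in> S"
  obtain B where B: "B > 0" "\<And>v. B * norm v \<le> norm (A x0 v)"
    using linear_inj_bounded_below_pos[OF A(1)[OF x0] inj[OF x0]] by blast
  \<comment> \<open>A multiple of the operator norm of \<open>A x - A x0\<close> is avoided:
    \<open>d x\<close> dominates it and, being a finite sum over a basis, tends to zero by
    continuity at each fixed vector.\<close>
  define d where "d x = (\<Sum>j\<in>Basis. norm (A x j - A x0 j))" for x
  have ev: "\<forall>\<^sub>F x in at x0. x \<in> S" using S x0 by (rule eventually_at_in_open')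
  have "((\<lambda>x. A x e) \<longlongrightarrow> A x0 e) (at x0)" for e
    using A(2) S x0 by (metis continuous_on_def at_within_open)
  then have "(d \<longlongrightarrow> (\<Sum>j\<in>Basis. norm (A x0 j - A x0 j :: 'b))) (at x0)"
    unfolding d_def by (intro tendsto_intros)
  then have d0: "(d \<longlongrightarrow> 0) (at x0)" by simp
  have "(w \<longlongrightarrow> w x0) (at x0)" using w S x0 by (metis continuous_on_def at_within_open)
  then have lim: "((\<lambda>x. 2 / B * (norm (w x - w x0) + d x * norm (u x0))) \<longlongrightarrow>
      2 / B * (norm (w x0 - w x0) + 0 * norm (u x0))) (at x0)"
    by (intro tendsto_intros d0)
  have "((\<lambda>x. u x - u x0) \<longlongrightarrow> 0) (at x0)"
  proof (rule Lim_null_comparison)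
    show "((\<lambda>x. 2 / B * (norm (w x - w x0) + d x * norm (u x0))) \<longlongrightarrow> 0) (at x0)"
      using lim by simp
    \<comment> \<open>Below \<open>B / 2\<close>, half of the lower bound remains after
      \<open>d x * norm (u x - u x0)\<close> is absorbed.\<close>
    have "\<forall>\<^sub>F x in at x0. d x < B / 2" using order_tendstoD(2)[OF d0, of "B / 2"] B by simp
    with ev show "\<forall>\<^sub>F x in at x0. norm (u x - u x0) \<le> 2 / B * (norm (w x - w x0) + d x * norm (u x0))"
    proof eventually_elim
      case (elim x)
      have lin: "linear (\<lambda>v. A x v - A x0 v)"
        using A(1)[OF elim(1)] A(1)[OF x0] by (rule linear_compose_sub)
      have "A x0 (u x - u x0) = (w x - w x0) - (A x (u x) - A x0 (u x))"
        using eq x0 elim(1) linear_diff[OF A(1)[OF x0]] by simp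
      then have "B * norm (u x - u x0) \<le> norm ((w x - w x0) - (A x (u x) - A x0 (u x)))"
        using B(2)[of "u x - u x0"] by simp
      also have "\<dots> \<le> norm (w x - w x0) + norm (A x (u x) - A x0 (u x))" by (rule norm_triangle_ineq4)
      also have "norm (A x (u x) - A x0 (u x)) \<le> d x * norm (u x)"
        using linear_norm_le[OF lin] unfolding d_def .
      also have "d x * norm (u x) \<le> d x * (norm (u x - u x0) + norm (u x0))"
        by (rule mult_left_mono) (auto simp: d_def sum_nonneg norm_triangle_sub add.commute)
      also have "\<dots> \<le> B / 2 * norm (u x - u x0) + d x * norm (u x0)"
        using mult_right_mono[OF less_imp_le[OF elim(2)], of "norm (u x - u x0)"] by (simp add: distrib_left)
      finally have "B / 2 * norm (u x - u x0) \<le> norm (w x - w x0) + d x * norm (u x0)" by simp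
      then show ?case using B(1) by (simp add: field_simps)
    qed
  qed
  then have "(u \<longlongrightarrow> u x0) (at x0)" by (simp add: LIM_zero_iff)
  then show "isCont u x0" by (simp add: isCont_def)
qed

text \<open>The graph map sending \<open>y\<close> to \<open>(y, u y)\<close> is a continuous lift
  of \<open>(y, w y)\<close> through \<open>G (y, e) = (y, A y e)\<close>, so
  \<open>has_derivative_lift\<close> applies. Passing to graphs makes the varying coefficients part
  of one fixed map.\<close>

lemma linear_family_differentiable_solution:
  fixes A :: "'a::real_normed_vector \<Rightarrow> 'e::euclidean_space \<Rightarrow> 'b::euclidean_space"
  assumes S: "open S" and A: "\<And>x. x \<in> S \<Longrightarrow> linear (A x)"
    "\<And>e x. x \<in> S \<Longrightarrow> ((\<lambda>x. A x e) has_derivative A' x e) (at x)"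
    and inj: "\<And>x. x \<in> S \<Longrightarrow> inj (A x)"
    and w: "\<And>x. x \<in> S \<Longrightarrow> (w has_derivative w' x) (at x)"
    and eq: "\<And>x. x \<in> S \<Longrightarrow> A x (u x) = w x" and x: "x \<in> S"
  shows "u differentiable (at x)"
proof -
  \<comment> \<open>\<open>A y e\<close> is written out in a basis, so that the product rule
    differentiates \<open>G\<close> in both variables at once.\<close>
  define G where "G = (\<lambda>(y, e). (y, \<Sum>j\<in>Basis. (e \<bullet> j) *\<^sub>R A y j))"
  define G' where "G' = (\<lambda>(\<xi>, \<eta>). (\<xi>, A x \<eta> + (\<Sum>j\<in>Basis. (u x \<bullet> j) *\<^sub>R A' x j \<xi>)))"
  obtain L where L: "linear L" "L \<circ> A x = id"
    using linear_injective_left_inverse[OF A(1)[OF x] inj[OF x]] by blast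
  then have bL: "bounded_linear L" by (simp add: linear_conv_bounded_linear)
  \<comment> \<open>\<open>M\<close> is the left inverse of \<open>G'\<close>: the contribution of
    the base direction is subtracted before \<open>L\<close> is applied.\<close>
  define M where "M = (\<lambda>(\<xi>, \<zeta>). (\<xi>, L (\<zeta> - (\<Sum>j\<in>Basis. (u x \<bullet> j) *\<^sub>R A' x j \<xi>))))"
  have cu: "continuous_on S u"
    using S A(1) _ inj _ eq
    by (rule linear_family_continuous_solution)
      (auto intro!: continuous_at_imp_continuous_on intro: has_derivative_continuous A(2) w)
  have bA': "bounded_linear (A' x j)" for j using A(2)[OF x] by (rule has_derivative_bounded_linear)
  have Ax: "A x \<eta> = (\<Sum>j\<in>Basis. (\<eta> \<bullet> j) *\<^sub>R A x j)" for \<eta>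
    by (rule linear_basis_expansion) (use A x in auto)
  have "((\<lambda>y. (y, u y)) has_derivative (\<lambda>v. M (v, w' x v))) (at x)"
  proof (rule has_derivative_lift[where L = M and G = G and G' = G' and K = "\<lambda>x. (x, w x)"])
    have "((\<lambda>p. A (fst p) j) has_derivative (\<lambda>p. A' x j (fst p))) (at (x, u x))" for j
      by (rule has_derivative_compose[OF has_derivative_fst[OF has_derivative_ident]]) (simp add: A x)
    then have "((\<lambda>p. (fst p, \<Sum>j\<in>Basis. (snd p \<bullet> j) *\<^sub>R A (fst p) j)) has_derivative
       (\<lambda>p. (fst p, \<Sum>j\<in>Basis. (snd (x, u x) \<bullet> j) *\<^sub>R A' x j (fst p) + (snd p \<bullet> j) *\<^sub>R A (fst (x, u x)) j))) (at (x, u x))"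
      by (intro has_derivative_Pair has_derivative_sum has_derivative_scaleR has_derivative_fst
          has_derivative_ident has_derivative_inner_left has_derivative_snd)
    then show "(G has_derivative G') (at (x, u x))"
      unfolding G_def G'_def case_prod_unfold
      by (simp add: Ax[symmetric] sum.distrib add.commute)
    show "bounded_linear M"
      unfolding M_def case_prod_unfold
      by (intro bounded_linear_Pair bounded_linear_compose[OF bL] bounded_linear_sub bounded_linear_sum
          bounded_linear_compose[OF bounded_linear_scaleR_right] bounded_linear_compose[OF bA']
          bounded_linear_fst bounded_linear_snd)
    show "M (G' v) = v" for v
      using L(2) by (auto simp: M_def G'_def case_prod_unfold fun_eq_iff)
    show "((\<lambda>x. (x, w x)) has_derivative (\<lambda>v. (v, w' x v))) (at x)"
      by (intro has_derivative_Pair has_derivative_ident w x)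
    show "isCont (\<lambda>y. (y, u y)) x"
      using cu S x by (auto intro!: continuous_Pair simp: continuous_on_eq_continuous_at)
    have "\<forall>\<^sub>F y in nhds x. y \<in> S" using S x by (rule eventually_nhds_in_open)
    then show "\<forall>\<^sub>F y in nhds x. G (y, u y) = (y, w y)"
      by eventually_elim (simp add: G_def linear_basis_expansion[OF A(1), symmetric] eq)
  qed
  from has_derivative_snd[OF this] show ?thesis by (auto simp: differentiable_def)
qed

text \<open>Differentiating \<open>A x (u x) = w x\<close> gives, for each directional derivative of
  \<open>u\<close>, a linear equation with the same coefficients and a new right-hand side built
  from \<open>u\<close> and the derivatives of \<open>A\<close> and \<open>w\<close>. The induction
  therefore generalises over \<open>u\<close> and \<open>w\<close>.\<close>

lemma Ck_on_linear_solution: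
  fixes A :: "'a::real_normed_vector \<Rightarrow> 'e::euclidean_space \<Rightarrow> 'b::euclidean_space"
  assumes S: "open S" and A: "\<And>x. x \<in> S \<Longrightarrow> linear (A x)" "\<And>x. x \<in> S \<Longrightarrow> inj (A x)"
  shows "\<lbrakk>\<And>e. Ck_on k S (\<lambda>x. A x e); Ck_on k S w; \<And>x. x \<in> S \<Longrightarrow> A x (u x) = w x\<rbrakk> \<Longrightarrow> Ck_on k S u"
proof (induction k arbitrary: u w)
  case 0
  then show ?case unfolding Ck_on.simps
    by (intro linear_family_continuous_solution[OF S, where A = A and w = w and u = u] A) auto
next
  case (Suc k)
  let ?A' = "\<lambda>x e. frechet_derivative (\<lambda>x. A x e) (at x)"
  note dA = Ck_on_has_derivative[OF Suc.prems(1)] and dw = Ck_on_has_derivative[OF Suc.prems(2)]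
  have du: "u differentiable (at x)" if "x \<in> S" for x
    using S A(1) dA A(2) dw Suc.prems(3) that by (rule linear_family_differentiable_solution)
  have Aexp: "A x v = (\<Sum>j\<in>Basis. (v \<bullet> j) *\<^sub>R A x j)" if "x \<in> S" for x v
    by (rule linear_basis_expansion) (use A that in auto)
  \<comment> \<open>The differentiated equation has \<open>u\<close> on its right-hand side, so
    \<open>u\<close> must first be of class C^k; this is the induction hypothesis for the original
    equation.\<close>
  have uk: "Ck_on k S u"
    by (rule Suc.IH[of w u]) (rule Ck_on_lower[OF Suc.prems(1)] Ck_on_lower[OF Suc.prems(2)] Suc.prems(3), assumption?)+
  have "Ck_on k S (\<lambda>x. frechet_derivative u (at x) v)" for v
  proof (rule Suc.IH)
    show "Ck_on k S (\<lambda>x. A x e)" for e using Suc.prems(1) by (rule Ck_on_lower)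
    show "Ck_on k S (\<lambda>x. frechet_derivative w (at x) v - (\<Sum>j\<in>Basis. (u x \<bullet> j) *\<^sub>R ?A' x j v))"
      unfolding diff_conv_add_uminus
      by (intro Ck_on_add S Ck_on_bounded_linear[OF S bounded_linear_minus[OF bounded_linear_ident]]
          Ck_on_sum Ck_on_scaleR Ck_on_bounded_linear[OF S _ uk, of "\<lambda>v. v \<bullet> _"] bounded_linear_inner_left)
        (use Suc.prems in auto)
    fix x assume x: "x \<in> S"
    have "((\<lambda>x. \<Sum>j\<in>Basis. (u x \<bullet> j) *\<^sub>R A x j) has_derivative
        (\<lambda>v. \<Sum>j\<in>Basis. (u x \<bullet> j) *\<^sub>R ?A' x j v + (frechet_derivative u (at x) v \<bullet> j) *\<^sub>R A x j)) (at x)"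
      using du[OF x] dA[OF x] unfolding frechet_derivative_works
      by (intro has_derivative_sum has_derivative_scaleR has_derivative_inner_left)
    moreover have "(\<Sum>j\<in>Basis. (u y \<bullet> j) *\<^sub>R A y j) = w y" if "y \<in> S" for y
      by (simp add: Aexp[OF that, symmetric] Suc.prems(3)[OF that])
    ultimately have "(w has_derivative
        (\<lambda>v. \<Sum>j\<in>Basis. (u x \<bullet> j) *\<^sub>R ?A' x j v + (frechet_derivative u (at x) v \<bullet> j) *\<^sub>R A x j)) (at x)"
      by (rule has_derivative_transform_within_open[OF _ S x])
    then have "frechet_derivative w (at x) =
        (\<lambda>v. \<Sum>j\<in>Basis. (u x \<bullet> j) *\<^sub>R ?A' x j v + (frechet_derivative u (at x) v \<bullet> j) *\<^sub>R A x j)"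
      by (rule frechet_derivative_at[symmetric])
    then show "A x (frechet_derivative u (at x) v) =
        frechet_derivative w (at x) v - (\<Sum>j\<in>Basis. (u x \<bullet> j) *\<^sub>R ?A' x j v)"
      by (subst Aexp[OF x]) (simp add: sum.distrib)
  qed
  with du show ?case by simp
qed

section \<open>Smooth lifts and local injectivity\<close>

lemma smooth_on_imp_has_derivative:
  "smooth_on S f \<Longrightarrow> x \<in> S \<Longrightarrow> (f has_derivative frechet_derivative f (at x)) (at x)"
  unfolding smooth_on_def using Ck_on_has_derivative by blast

lemma smooth_on_derivative: "smooth_on S f \<Longrightarrow> smooth_on S (\<lambda>x. frechet_derivative f (at x) v)"
  unfolding smooth_on_def by (metis Ck_on.simps(2))

lemma smooth_on_compose:
  fixes g :: "'a::real_normed_vector \<Rightarrow> 'e::euclidean_space"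
  assumes "smooth_on T f" "smooth_on S g" "g ` S \<subseteq> T"
  shows "smooth_on S (\<lambda>x. f (g x))"
  using assms Ck_on_compose unfolding smooth_on_def by blast

lemma has_derivative_lift_inj:
  fixes G :: "'e::euclidean_space \<Rightarrow> 'f::euclidean_space"
  assumes "(G has_derivative G') (at (h x))" "inj G'" "K differentiable (at x)" "isCont h x"
    and "\<forall>\<^sub>F y in nhds x. G (h y) = K y"
  shows "h differentiable (at x)"
proof -
  obtain L where "linear L" "L \<circ> G' = id"
    using linear_injective_left_inverse assms(1,2) has_derivative_linear by blast
  moreover obtain K' where "(K has_derivative K') (at x)"
    using assms(3) by (auto simp: differentiable_def)
  ultimately have "(h has_derivative (\<lambda>v. L (K' v))) (at x)"
    using assms by (intro has_derivative_lift[where G = G and G' = G' and K = K])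
      (auto simp: linear_conv_bounded_linear fun_eq_iff)
  then show ?thesis by (auto simp: differentiable_def)
qed

text \<open>Differentiating \<open>G (h x) = K x\<close> exhibits the derivative of \<open>h\<close>
  as the solution of a linear equation with injective coefficients. These are evaluated along
  \<open>h\<close>, so each order of differentiability of \<open>h\<close> yields the next.\<close>

lemma smooth_on_lift:
  fixes h :: "'a::real_normed_vector \<Rightarrow> 'e::euclidean_space" and G :: "'e \<Rightarrow> 'f::euclidean_space"
  assumes G: "smooth_on U G" "\<And>y. y \<in> U \<Longrightarrow> inj (frechet_derivative G (at y))"
    and h: "continuous_on S h" "h ` S \<subseteq> U"
    and K: "smooth_on S K" and eq: "\<And>x. x \<in> S \<Longrightarrow> G (h x) = K x"
  shows "smooth_on S h"
proof -
  have S: "open S" and U: "open U" using G K by (auto simp: smooth_on_def)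
  have GC: "Ck_on k U G" for k using G by (auto simp: smooth_on_def)
  note dG = smooth_on_imp_has_derivative[OF G(1)] and dK = smooth_on_imp_has_derivative[OF K]
  have dh: "h differentiable (at x)" if x: "x \<in> S" for x
  proof (rule has_derivative_lift_inj)
    show "(G has_derivative frechet_derivative G (at (h x))) (at (h x))" "inj (frechet_derivative G (at (h x)))"
      using dG G(2) h(2) x by auto
    show "K differentiable (at x)" using dK[OF x] by (auto simp: differentiable_def)
    show "isCont h x" using h(1) S x by (simp add: continuous_on_eq_continuous_at)
    have "\<forall>\<^sub>F y in nhds x. y \<in> S" using S x by (rule eventually_nhds_in_open)
    then show "\<forall>\<^sub>F y in nhds x. G (h y) = K y" by eventually_elim (rule eq)
  qed
  have "Ck_on k S h" for k
  proof (induction k)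
    case 0
    then show ?case using h by simp
  next
    case (Suc k)
    have "Ck_on k S (\<lambda>x. frechet_derivative h (at x) v)" for v
    proof (rule Ck_on_linear_solution[OF S])
      show "Ck_on k S (\<lambda>x. frechet_derivative G (at (h x)) e)" for e
        using GC[of "Suc k"] by (intro Ck_on_compose[OF S U h(2) _ Suc]) simp
      show "Ck_on k S (\<lambda>x. frechet_derivative K (at x) v)"
        using K unfolding smooth_on_def by (metis Ck_on.simps(2))
      fix x assume x: "x \<in> S"
      then have hx: "h x \<in> U" using h by auto
      show "linear (frechet_derivative G (at (h x)))" using dG[OF hx] by (rule has_derivative_linear)
      show "inj (frechet_derivative G (at (h x)))" using G(2) hx .
      have "((\<lambda>x. G (h x)) has_derivative (\<lambda>v. frechet_derivative G (at (h x)) (frechet_derivative h (at x) v))) (at x)"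
        using dh[OF x] dG[OF hx] unfolding frechet_derivative_works by (rule has_derivative_compose)
      then have "(K has_derivative (\<lambda>v. frechet_derivative G (at (h x)) (frechet_derivative h (at x) v))) (at x)"
        using S x eq by (rule has_derivative_transform_within_open)
      then show "frechet_derivative G (at (h x)) (frechet_derivative h (at x) v) = frechet_derivative K (at x) v"
        by (metis frechet_derivative_at)
    qed
    with dh show ?case by simp
  qed
  with S show ?thesis by (simp add: smooth_on_def)
qed

text \<open>Local injectivity rests on the derivative of \<open>G\<close> varying continuously in
  operator norm near \<open>a\<close>, which follows from continuity of the derivatives along the
  finitely many basis vectors.\<close>

lemma smooth_on_locally_injective:
  fixes G :: "'e::euclidean_space \<Rightarrow> 'f::euclidean_space"
  assumes G: "smooth_on U G" and a: "a \<in> U" and inj: "inj (frechet_derivative G (at a))"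
  obtains r where "r > 0" "ball a r \<subseteq> U" "inj_on G (ball a r)"
proof -
  have U: "open U" using G by (simp add: smooth_on_def)
  note dG = smooth_on_imp_has_derivative[OF G]
  obtain L where L: "linear L" "L \<circ> frechet_derivative G (at a) = id"
    using linear_injective_left_inverse has_derivative_linear[OF dG[OF a]] inj by blast
  have on: "\<exists>d>0. \<forall>x. dist a x < d \<longrightarrow>
      onorm (\<lambda>v. frechet_derivative G (at x) v - frechet_derivative G (at a) v) < e" if e: "e > 0" for e
  proof -
    define d where "d x = (\<Sum>j\<in>Basis. norm (frechet_derivative G (at x) j - frechet_derivative G (at a) j))" for x
    have "Ck_on 0 U (\<lambda>x. frechet_derivative G (at x) v)" for v
      using smooth_on_derivative[OF G] unfolding smooth_on_def by blast
    then have "isCont (\<lambda>x. frechet_derivative G (at x) v) a" for v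
      using U a by (simp add: continuous_on_eq_continuous_at)
    then have "isCont d a" unfolding d_def by (intro continuous_intros) auto
    then obtain r where r: "r > 0" "\<And>x. dist x a < r \<Longrightarrow> dist (d x) (d a) < e"
      using e unfolding continuous_at_eps_delta by blast
    obtain r' where r': "r' > 0" "ball a r' \<subseteq> U" using U a openE by blast
    show ?thesis
    proof (intro exI[of _ "min r r'"] conjI allI impI)
      fix x assume x: "dist a x < min r r'"
      then have lin: "linear (\<lambda>v. frechet_derivative G (at x) v - frechet_derivative G (at a) v)"
        using r' a by (intro linear_compose_sub has_derivative_linear[OF dG]) auto
      have "onorm (\<lambda>v. frechet_derivative G (at x) v - frechet_derivative G (at a) v) \<le> d x"
        using linear_norm_le[OF lin] by (intro onorm_bound) (auto simp: d_def sum_nonneg)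
      also have "d x < e" using r(2)[of x] x by (auto simp: d_def dist_commute dist_real_def)
      finally show "onorm (\<lambda>v. frechet_derivative G (at x) v - frechet_derivative G (at a) v) < e" .
    qed (use r r' in auto)
  qed
  show thesis
    using has_derivative_locally_injective[OF a U _ L(2) dG on] L(1) that
    by (auto simp: linear_conv_bounded_linear)
qed

section \<open>Closure properties of smooth maps\<close>

lemma smooth_on_subset: "smooth_on S f \<Longrightarrow> open T \<Longrightarrow> T \<subseteq> S \<Longrightarrow> smooth_on T f"
  by (auto simp: smooth_on_def intro: Ck_on_subset)

lemma smooth_on_cong:
  "smooth_on S f \<Longrightarrow> (\<And>x. x \<in> S \<Longrightarrow> f x = g x) \<Longrightarrow> smooth_on S g"
  unfolding smooth_on_def using Ck_on_cong by blast

lemma smooth_on_const: "open S \<Longrightarrow> smooth_on S (\<lambda>x. c)"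
  by (simp add: smooth_on_def Ck_on_const)

lemma smooth_on_bounded_linear:
  "bounded_linear L \<Longrightarrow> smooth_on S f \<Longrightarrow> smooth_on S (\<lambda>x. L (f x))"
  by (simp add: smooth_on_def Ck_on_bounded_linear)

lemma smooth_on_add: "smooth_on S f \<Longrightarrow> smooth_on S g \<Longrightarrow> smooth_on S (\<lambda>x. f x + g x)"
  by (simp add: smooth_on_def Ck_on_add)

lemma smooth_on_sum:
  "open S \<Longrightarrow> (\<And>i. i \<in> I \<Longrightarrow> smooth_on S (f i)) \<Longrightarrow> smooth_on S (\<lambda>x. \<Sum>i\<in>I. f i x)"
  by (simp add: smooth_on_def Ck_on_sum)

lemma smooth_on_scaleR:
  "smooth_on S a \<Longrightarrow> smooth_on S f \<Longrightarrow> smooth_on S (\<lambda>x. a x *\<^sub>R f x)"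
  by (simp add: smooth_on_def Ck_on_scaleR)

lemma smooth_on_mult:
  fixes a b :: "'a::real_normed_vector \<Rightarrow> real"
  shows "smooth_on S a \<Longrightarrow> smooth_on S b \<Longrightarrow> smooth_on S (\<lambda>x. a x * b x)"
  using smooth_on_scaleR[of S a b] by simp

lemma smooth_on_diff:
  assumes "smooth_on S f" "smooth_on S g"
  shows "smooth_on S (\<lambda>x. f x - g x)"
  using smooth_on_add[OF assms(1) smooth_on_bounded_linear[OF bounded_linear_minus[OF bounded_linear_ident] assms(2)]]
  by simp

lemma smooth_on_derivative_along:
  fixes f :: "'e::euclidean_space \<Rightarrow> 'b::real_normed_vector"
  assumes f: "smooth_on S f" and X: "smooth_on S X"
  shows "smooth_on S (\<lambda>x. frechet_derivative f (at x) (X x))"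
proof -
  have "linear (frechet_derivative f (at x))" if "x \<in> S" for x
    using smooth_on_imp_has_derivative[OF f that] by (rule has_derivative_linear)
  then have "Ck_on k S (\<lambda>x. frechet_derivative f (at x) (X x))" for k
    by (rule Ck_on_linear_family[where A = "\<lambda>x. frechet_derivative f (at x)", rotated])
      (use f X smooth_on_derivative[OF f] in \<open>simp_all add: smooth_on_def\<close>)
  with f show ?thesis by (simp add: smooth_on_def)
qed

lemma smooth_on_imp_differentiable: "smooth_on S f \<Longrightarrow> x \<in> S \<Longrightarrow> f differentiable (at x)"
  using smooth_on_imp_has_derivative differentiable_def by blast

text \<open>Both functions have the same derivatives at \<open>x\<close>, so the choice in the
  definition of \<open>frechet_derivative\<close> agrees even where no derivative exists.\<close>

lemma frechet_derivative_cong: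
  assumes "open S" "x \<in> S" "\<And>y. y \<in> S \<Longrightarrow> f y = g y"
  shows "frechet_derivative f (at x) = frechet_derivative g (at x)"
proof -
  have "(f has_derivative L) (at x) \<longleftrightarrow> (g has_derivative L) (at x)" for L
    using assms by (metis has_derivative_transform_within_open)
  then show ?thesis by (simp add: frechet_derivative_def)
qed

subsection \<open>The real part of the immersion\<close>

definition re_part :: "'n::finite cotangent \<Rightarrow> (real^'n) \<times> (real^'n)" where
  "re_part v = (\<chi> i. x_coord i v, \<chi> i. y_coord i v)"

lemma linear_re_part: "linear re_part"
  by (rule linearI) (auto simp: re_part_def x_coord_def y_coord_def vec_eq_iff)

lemma linear_x_coord: "linear (x_coord i)" and linear_y_coord: "linear (y_coord i)"
  by (rule linearI; auto simp: x_coord_def y_coord_def)+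

lemma re_part_eq_iff:
  "re_part u = re_part v \<longleftrightarrow> (\<forall>i. x_coord i u = x_coord i v \<and> y_coord i u = y_coord i v)"
  by (auto simp: re_part_def vec_eq_iff)

lemma scale_V_simps:
  "scale_V l (scale_V m v) = scale_V (l * m) v" "scale_V 1 v = v" "scale_V l 0 = 0"
  "scale_V l (u + v) = scale_V l u + scale_V l v"
  "scale_V (l + m) v = scale_V l v + scale_V m v"
  "scale_V l (r *\<^sub>R v) = r *\<^sub>R scale_V l v" "scale_V (r *\<^sub>R l) v = r *\<^sub>R scale_V l v"
  by (auto simp: scale_V_def case_prod_unfold vec_eq_iff prod_eq_iff algebra_simps)

lemma bilinear_scale_V: "bounded_bilinear (scale_V :: complex \<Rightarrow> 'n::finite cotangent \<Rightarrow> 'n cotangent)"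
proof -
  have "linear (scale_V l :: 'n cotangent \<Rightarrow> 'n cotangent)" for l by (rule linearI; rule scale_V_simps)
  moreover have "linear (\<lambda>l. scale_V l (v :: 'n cotangent))" for v by (rule linearI; rule scale_V_simps)
  ultimately show ?thesis
    unfolding bilinear_conv_bounded_bilinear[symmetric] bilinear_def by blast
qed

text \<open>Such a vector is purely imaginary, and multiplication by the imaginary unit makes it
  real.\<close>

lemma J_V_mem_V_tau: "re_part v = 0 \<Longrightarrow> J_V v \<in> V_tau"
  by (auto simp: re_part_def x_coord_def y_coord_def V_tau_def tau_def scale_V_def case_prod_unfold
      vec_eq_iff prod_eq_iff complex_eq_iff)

locale conic_totally_complex =
  fixes A :: "('m::t2_space, 'n::finite) chart set"
    and \<phi> :: "'m \<Rightarrow> 'n cotangent"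
    and nabla :: "('m, 'n) conn"
  assumes atlas: "complex_atlas A"
    and totally_complex: "totally_complex A \<phi>"
    and conic: "conic_immersion \<phi>"
    and induced: "induced_connection A \<phi> nabla"
begin

section \<open>Charts and the differential of the immersion\<close>

lemma open_dom: "c \<in> A \<Longrightarrow> open (fst c)"
  and open_ran: "c \<in> A \<Longrightarrow> open (snd c ` fst c)"
  and chart_homeo: "c \<in> A \<Longrightarrow> homeomorphism (fst c) (snd c ` fst c) (snd c) (chart_inv c)"
  using atlas by (auto simp: complex_atlas_def is_chart_def)

lemma chart_exists: obtains c where "c \<in> A" "p \<in> fst c"
  using atlas unfolding complex_atlas_def by blast

lemma chart_inv_left [simp]: "c \<in> A \<Longrightarrow> p \<in> fst c \<Longrightarrow> chart_inv c (snd c p) = p"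
  using chart_homeo by (rule homeomorphism_apply1)

lemma chart_continuous: "c \<in> A \<Longrightarrow> continuous_on (fst c) (snd c)"
  and chart_inv_continuous: "c \<in> A \<Longrightarrow> continuous_on (snd c ` fst c) (chart_inv c)"
  using chart_homeo by (auto simp: homeomorphism_def)

lemma open_chart_image:
  assumes "c \<in> A" "open D" shows "open (snd c ` (D \<inter> fst c))"
proof -
  have "snd c ` (D \<inter> fst c) = snd c ` fst c \<inter> chart_inv c -` D"
    using assms by auto
  then show ?thesis
    using continuous_open_preimage[OF chart_inv_continuous open_ran] assms by simp
qed

lemma diff_in_cong:
  assumes "c \<in> A" "open D" "p \<in> D \<inter> fst c" "\<And>q. q \<in> D \<inter> fst c \<Longrightarrow> f q = g q"
  shows "diff_in c f p = diff_in c g p"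
  unfolding diff_in_def
  by (rule frechet_derivative_cong[OF open_chart_image[OF assms(1,2)]]) (use assms in auto)

lemma phi_has_derivative:
  assumes "c \<in> A" "p \<in> fst c"
  shows "(\<phi> \<circ> chart_inv c has_derivative diff_in c \<phi> p) (at (snd c p))"
    and "diff_in c \<phi> p (J_vec v) = J_V (diff_in c \<phi> p v)"
proof -
  have "holomorphic_wrt J_vec J_V (snd c ` (UNIV \<inter> fst c)) (\<phi> \<circ> chart_inv c)"
    using totally_complex assms unfolding totally_complex_def holomorphic_immersion_def holomorphic_fun_def by blast
  then obtain L where L: "(\<phi> \<circ> chart_inv c has_derivative L) (at (snd c p))" "\<forall>v. L (J_vec v) = J_V (L v)"
    using assms unfolding holomorphic_wrt_def by auto
  moreover have "diff_in c \<phi> p = L" unfolding diff_in_def using L(1) by (rule frechet_derivative_at[symmetric])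
  ultimately show "(\<phi> \<circ> chart_inv c has_derivative diff_in c \<phi> p) (at (snd c p))"
     "diff_in c \<phi> p (J_vec v) = J_V (diff_in c \<phi> p v)" by auto
qed

lemma diff_phi_linear: "c \<in> A \<Longrightarrow> p \<in> fst c \<Longrightarrow> linear (diff_in c \<phi> p)"
  using phi_has_derivative(1) by (rule has_derivative_linear)

lemma diff_phi_scale:
  assumes "c \<in> A" "p \<in> fst c" shows "diff_in c \<phi> p (l *s v) = scale_V l (diff_in c \<phi> p v)"
proof -
  have "l *s v = Re l *\<^sub>R v + Im l *\<^sub>R J_vec v"
    by (auto simp: J_vec_def vec_eq_iff complex_eq_iff)
  moreover have "scale_V l w = Re l *\<^sub>R w + Im l *\<^sub>R J_V w" for w :: "'n cotangent"
    by (auto simp: scale_V_def case_prod_unfold prod_eq_iff vec_eq_iff complex_eq_iff)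
  ultimately show ?thesis
    using diff_phi_linear[OF assms] phi_has_derivative(2)[OF assms]
    by (simp add: linear_add linear_cmul)
qed

text \<open>The difference of the two vectors has a purely imaginary image. \<open>J_V\<close> moves
  that image into \<open>V_tau\<close> and, by complex linearity, keeps it in the range of the
  differential, where total complexity leaves only zero.\<close>

lemma re_part_diff_phi_inj:
  assumes "c \<in> A" "p \<in> fst c" "re_part (diff_in c \<phi> p u) = re_part (diff_in c \<phi> p v)"
  shows "u = v"
proof -
  have lin: "linear (diff_in c \<phi> p)" by (rule diff_phi_linear[OF assms(1,2)])
  have "re_part (diff_in c \<phi> p (u - v)) = 0"
    using assms(3) by (simp add: linear_diff[OF lin] linear_diff[OF linear_re_part])
  then have "J_V (diff_in c \<phi> p (u - v)) \<in> V_tau" by (rule J_V_mem_V_tau)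
  then have "diff_in c \<phi> p (J_vec (u - v)) \<in> V_tau \<inter> range (diff_in c \<phi> p)"
    unfolding phi_has_derivative(2)[OF assms(1,2), symmetric] by blast
  then have "diff_in c \<phi> p (J_vec (u - v)) = diff_in c \<phi> p 0"
    using totally_complex assms(1,2) linear_0[OF lin] unfolding totally_complex_def by auto
  moreover have "inj (diff_in c \<phi> p)"
    using totally_complex assms(1,2) unfolding totally_complex_def holomorphic_immersion_def by blast
  ultimately have "J_vec (u - v) = 0" by (simp add: inj_eq)
  then show ?thesis by (auto simp: J_vec_def vec_eq_iff)
qed

text \<open>The functions \<open>x_coord i\<close> and \<open>y_coord i\<close> pulled back as a
  single map to a space of the same real dimension as the manifold; near every point it is a chart
  adapted to \<open>nabla\<close>.\<close>

definition F :: "'m \<Rightarrow> (real^'n) \<times> (real^'n)" where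
  "F p = re_part (\<phi> p)"

lemma affine_coords: "affine_fun A nabla UNIV (x_coord i \<circ> \<phi>)" "affine_fun A nabla UNIV (y_coord i \<circ> \<phi>)"
  using induced by (auto simp: induced_connection_def)

lemma affine_smooth:
  "affine_fun A nabla UNIV f \<Longrightarrow> c \<in> A \<Longrightarrow> smooth_on (snd c ` fst c) (f \<circ> chart_inv c)"
  unfolding affine_fun_def smooth_fun_def by auto

text \<open>Each component is affine for \<open>nabla\<close>, and smoothness is part of that
  notion.\<close>

lemma smooth_F: assumes "c \<in> A" shows "smooth_on (snd c ` fst c) (F \<circ> chart_inv c)"
proof (rule smooth_on_cong)
  let ?S = "snd c ` fst c"
  show "smooth_on ?S (\<lambda>x. (\<Sum>i\<in>UNIV. (x_coord i \<circ> \<phi> \<circ> chart_inv c) x *\<^sub>R (axis i 1, 0)) +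
      (\<Sum>i\<in>UNIV. (y_coord i \<circ> \<phi> \<circ> chart_inv c) x *\<^sub>R (0, axis i 1)))"
    by (intro smooth_on_add smooth_on_sum smooth_on_scaleR smooth_on_const open_ran assms
        affine_smooth affine_coords)
  fix x
  show "(\<Sum>i\<in>UNIV. (x_coord i \<circ> \<phi> \<circ> chart_inv c) x *\<^sub>R (axis i 1, 0)) +
      (\<Sum>i\<in>UNIV. (y_coord i \<circ> \<phi> \<circ> chart_inv c) x *\<^sub>R (0, axis i 1)) = (F \<circ> chart_inv c) x"
    by (auto simp: F_def re_part_def prod_eq_iff vec_eq_iff fst_sum snd_sum axis_def if_distrib
        cong: if_cong)
qed

lemma diff_in_linear_phi:
  fixes g :: "'n cotangent \<Rightarrow> 'b::real_normed_vector"
  assumes "c \<in> A" "p \<in> fst c" "linear g"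
  shows "diff_in c (g \<circ> \<phi>) p v = g (diff_in c \<phi> p v)"
proof -
  have "(g \<circ> \<phi> \<circ> chart_inv c has_derivative (\<lambda>v. g (diff_in c \<phi> p v))) (at (snd c p))"
    using bounded_linear.has_derivative[OF _ phi_has_derivative(1)[OF assms(1,2)], of g] assms(3)
    by (simp add: linear_conv_bounded_linear o_def)
  then show ?thesis unfolding diff_in_def by (metis frechet_derivative_at)
qed

lemma inj_diff_F:
  assumes "c \<in> A" "p \<in> fst c" shows "inj (diff_in c F p)"
proof -
  have "F = re_part \<circ> \<phi>" by (simp add: F_def fun_eq_iff)
  then show ?thesis
    using diff_in_linear_phi[OF assms linear_re_part] re_part_diff_phi_inj[OF assms] by (auto intro!: injI)
qed

lemma inj_derivative_F:
  assumes "c \<in> A" "x \<in> snd c ` fst c" shows "inj (frechet_derivative (F \<circ> chart_inv c) (at x))"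
  using inj_diff_F assms unfolding diff_in_def by blast

lemma phi_continuous: "continuous_on UNIV \<phi>"
proof (rule continuous_at_imp_continuous_on, rule ballI)
  fix p :: 'm obtain c where c: "c \<in> A" "p \<in> fst c" by (rule chart_exists)
  have "continuous_on (snd c ` fst c) (\<phi> \<circ> chart_inv c)"
    using has_derivative_continuous[OF phi_has_derivative(1)[OF c(1)]]
    by (intro continuous_at_imp_continuous_on) blast
  then have "continuous_on (fst c) (\<phi> \<circ> chart_inv c \<circ> snd c)"
    by (rule continuous_on_compose[OF chart_continuous[OF c(1)]])
  then have "continuous_on (fst c) \<phi>"
    using c by (simp cong: continuous_on_cong)
  then show "isCont \<phi> p" using open_dom c by (simp add: continuous_on_eq_continuous_at)
qed

lemma F_continuous: "continuous_on S F"
  unfolding F_def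
  by (rule bounded_linear.continuous_on[OF linear_re_part[unfolded linear_conv_bounded_linear]
        continuous_on_subset[OF phi_continuous subset_UNIV]])

text \<open>The atlas states holomorphy to first order. A transition is also the continuous lift of
  \<open>F\<close> read in \<open>c\<close> through \<open>F\<close> read in \<open>c'\<close>, and
  such lifts are smooth.\<close>

lemma smooth_transition:
  assumes "c \<in> A" "c' \<in> A"
  shows "smooth_on (snd c ` (fst c' \<inter> fst c)) (snd c' \<circ> chart_inv c)"
proof (rule smooth_on_lift[OF smooth_F[OF assms(2)] inj_derivative_F[OF assms(2)]])
  let ?S = "snd c ` (fst c' \<inter> fst c)"
  show "continuous_on ?S (snd c' \<circ> chart_inv c)"
    using assms
    by (intro continuous_on_compose continuous_on_subset[OF chart_inv_continuous[of c]]
        continuous_on_subset[OF chart_continuous[of c']]) auto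
  show "(snd c' \<circ> chart_inv c) ` ?S \<subseteq> snd c' ` fst c'" using assms by auto
  show "smooth_on ?S (F \<circ> chart_inv c)"
    by (rule smooth_on_subset[OF smooth_F]) (use assms open_chart_image open_dom in auto)
  show "(F \<circ> chart_inv c') ((snd c' \<circ> chart_inv c) x) = (F \<circ> chart_inv c) x" if "x \<in> ?S" for x
    using that assms by auto
qed

lemma transition_has_derivative:
  assumes "c \<in> A" "c' \<in> A" "p \<in> fst c" "p \<in> fst c'"
  shows "(snd c' \<circ> chart_inv c has_derivative diff_in c (snd c') p) (at (snd c p))"
  unfolding diff_in_def by (rule smooth_on_imp_has_derivative[OF smooth_transition]) (use assms in auto)

lemma diff_in_change_chart:
  assumes c: "c \<in> A" "c' \<in> A" and p: "p \<in> fst c" "p \<in> fst c'"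
    and f: "(f \<circ> chart_inv c') differentiable (at (snd c' p))"
  shows "diff_in c f p u = diff_in c' f p (diff_in c (snd c') p u)"
proof -
  have "(f \<circ> chart_inv c' has_derivative diff_in c' f p) (at ((snd c' \<circ> chart_inv c) (snd c p)))"
    using f c p by (simp add: diff_in_def frechet_derivative_works[symmetric])
  with transition_has_derivative[OF c p]
  have "((\<lambda>x. (f \<circ> chart_inv c') ((snd c' \<circ> chart_inv c) x)) has_derivative
      (\<lambda>u. diff_in c' f p (diff_in c (snd c') p u))) (at (snd c p))"
    by (rule has_derivative_compose)
  then have "((f \<circ> chart_inv c) has_derivative (\<lambda>u. diff_in c' f p (diff_in c (snd c') p u))) (at (snd c p))"
    by (rule has_derivative_transform_within_open[OF _ open_chart_image[OF c(1) open_dom[OF c(2)]]])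
      (use c p in auto)
  then show ?thesis unfolding diff_in_def[of c f] by (metis frechet_derivative_at)
qed

section \<open>Test vector fields and affine functions\<close>

definition const_field :: "('m, 'n) chart \<Rightarrow> complex^'n \<Rightarrow> ('m, 'n) field" where
  "const_field c u = (\<lambda>c' p. diff_in c (snd c') p u)"

lemma const_field_same: assumes "c \<in> A" "p \<in> fst c" shows "const_field c u c p = u"
proof -
  have "((\<lambda>x. x) has_derivative (\<lambda>v. v)) (at (snd c p))" by (rule has_derivative_ident)
  then have "((snd c \<circ> chart_inv c) has_derivative (\<lambda>v. v)) (at (snd c p))"
    by (rule has_derivative_transform_within_open[OF _ open_ran[OF assms(1)]]) (use assms in auto)
  then show ?thesis unfolding const_field_def diff_in_def by (metis frechet_derivative_at)
qed

text \<open>These fields extend any tangent vector at a point of the chart with constant components.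
  They turn conditions on fields, such as torsion-freeness and parallelism, into pointwise
  statements.\<close>

lemma vector_field_const:
  assumes c: "c \<in> A" and E: "open E" "E \<subseteq> fst c"
  shows "vector_field A E (const_field c u)"
  unfolding vector_field_def
proof (intro conjI ballI)
  fix c' assume c': "c' \<in> A"
  let ?S = "snd c' ` (E \<inter> fst c')" and ?D = "\<lambda>x. frechet_derivative (snd c' \<circ> chart_inv c) (at x) u"
  have "smooth_on ?S (snd c \<circ> chart_inv c')"
    by (rule smooth_on_subset[OF smooth_transition[OF c' c]]) (use c' E open_chart_image in auto)
  then have "smooth_on ?S (\<lambda>y. ?D ((snd c \<circ> chart_inv c') y))"
    by (rule smooth_on_compose[OF smooth_on_derivative[OF smooth_transition[OF c c']]])
      (use c' E in auto)
  then show "smooth_on ?S (const_field c u c' \<circ> chart_inv c')"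
    by (rule smooth_on_cong) (simp add: const_field_def diff_in_def)
next
  fix c' c'' p assume c': "c' \<in> A" "c'' \<in> A" and p: "p \<in> E \<inter> fst c' \<inter> fst c''"
  show "const_field c u c'' p = diff_in c' (snd c'') p (const_field c u c' p)"
    unfolding const_field_def
    by (rule diff_in_change_chart)
      (use c c' p E transition_has_derivative[of c' c''] in \<open>auto simp: differentiable_def\<close>)
qed (rule E)

lemma vector_field_subset:
  assumes "vector_field A D X" "open E" "E \<subseteq> D" shows "vector_field A E X"
proof -
  have X: "\<forall>c\<in>A. smooth_on (snd c ` (D \<inter> fst c)) (X c \<circ> chart_inv c)"
    "\<forall>c\<in>A. \<forall>c'\<in>A. \<forall>p \<in> D \<inter> fst c \<inter> fst c'. X c' p = diff_in c (snd c') p (X c p)"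
    using assms(1) unfolding vector_field_def by blast+
  have "smooth_on (snd c ` (E \<inter> fst c)) (X c \<circ> chart_inv c)" if "c \<in> A" for c
    by (rule smooth_on_subset[OF X(1)[rule_format, OF that] open_chart_image[OF that assms(2)]])
      (use assms(3) in blast)
  with X(2) assms(2,3) show ?thesis unfolding vector_field_def by blast
qed

lemma affine_subset:
  assumes "affine_fun A nabla UNIV f" "open D" shows "affine_fun A nabla D f"
proof -
  have "smooth_on (snd c ` (D \<inter> fst c)) (f \<circ> chart_inv c)" if "c \<in> A" for c
    by (rule smooth_on_subset[OF affine_smooth[OF assms(1) that]]) (use that assms open_chart_image in auto)
  with assms(2) have "smooth_fun A D f" by (simp add: smooth_fun_def)
  moreover have "\<forall>E X Y. vector_field A E X \<and> vector_field A E Y \<longrightarrow>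
      (\<forall>c\<in>A. \<forall>p \<in> E \<inter> fst c.
        deriv_along c X (deriv_along c Y f) p - deriv_along c (nabla X Y) f p = 0)"
    using assms(1) by (simp add: affine_fun_def)
  ultimately show ?thesis unfolding affine_fun_def by blast
qed

lemma affineD:
  assumes "affine_fun A nabla UNIV f" "vector_field A D X" "vector_field A D Y" "c \<in> A" "p \<in> D \<inter> fst c"
  shows "deriv_along c X (deriv_along c Y f) p = deriv_along c (nabla X Y) f p"
  using assms by (simp add: affine_fun_def)

lemma smooth_deriv_along:
  assumes f: "affine_fun A nabla UNIV f" and X: "vector_field A D X" and c: "c \<in> A"
  shows "smooth_on (snd c ` (D \<inter> fst c)) (deriv_along c X f \<circ> chart_inv c)"
proof (rule smooth_on_cong)
  have D: "open D" using X by (simp add: vector_field_def)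
  have "smooth_on (snd c ` (D \<inter> fst c)) (f \<circ> chart_inv c)"
    by (rule smooth_on_subset[OF affine_smooth[OF f c] open_chart_image[OF c D]]) auto
  moreover have "smooth_on (snd c ` (D \<inter> fst c)) (X c \<circ> chart_inv c)"
    using X c by (simp add: vector_field_def)
  ultimately show "smooth_on (snd c ` (D \<inter> fst c))
     (\<lambda>x. frechet_derivative (f \<circ> chart_inv c) (at x) ((X c \<circ> chart_inv c) x))"
    by (rule smooth_on_derivative_along)
qed (use c in \<open>auto simp: deriv_along_def diff_in_def\<close>)

lemma diff_in_has_derivative:
  assumes "smooth_on (snd c ` (D \<inter> fst c)) (f \<circ> chart_inv c)" "p \<in> D \<inter> fst c"
  shows "(f \<circ> chart_inv c has_derivative diff_in c f p) (at (snd c p))"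
  unfolding diff_in_def by (rule smooth_on_imp_has_derivative[OF assms(1)]) (use assms in auto)

end

subsection \<open>The induced form and parallel fields\<close>

lemma sum_dx_dy_add_right: "sum_dx_dy u (v + w) = sum_dx_dy u v + sum_dx_dy u w"
  by (simp add: sum_dx_dy_def x_coord_def y_coord_def algebra_simps sum.distrib sum_subtractf)

lemma sum_dx_dy_scaleR_right: "sum_dx_dy u (r *\<^sub>R v) = r * sum_dx_dy u v"
  by (simp add: sum_dx_dy_def x_coord_def y_coord_def sum_distrib_left algebra_simps)

lemma sum_dx_dy_swap: "sum_dx_dy u v = - sum_dx_dy v u"
  by (simp add: sum_dx_dy_def sum_subtractf)

text \<open>Pairing \<open>u\<close> with a vector whose real part is \<open>(- y, x)\<close>, where
  \<open>(x, y)\<close> is the real part of \<open>u\<close>, gives a sum of squares. In the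
  application \<open>g\<close> is the differential of the immersion at a point.\<close>

lemma sum_dx_dy_nondegenerate:
  assumes "\<And>w. sum_dx_dy u (g w) = 0" "surj (\<lambda>w. re_part (g w))"
  shows "re_part u = re_part 0"
proof -
  obtain w where "(\<chi> i. - y_coord i u, \<chi> i. x_coord i u) = re_part (g w)"
    by (rule surjE[OF assms(2)])
  then have "x_coord i (g w) = - y_coord i u" "y_coord i (g w) = x_coord i u" for i
    by (auto simp: re_part_def vec_eq_iff)
  then have "(\<Sum>i\<in>UNIV. x_coord i u * x_coord i u + y_coord i u * y_coord i u) = 0"
    using assms(1)[of w] by (simp add: sum_dx_dy_def)
  then have "x_coord i u * x_coord i u + y_coord i u * y_coord i u = 0" for i
    using sum_nonneg_eq_0_iff[of UNIV "\<lambda>i. x_coord i u * x_coord i u + y_coord i u * y_coord i u"] by simp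
  then show ?thesis
    unfolding re_part_eq_iff by (simp add: sum_squares_eq_zero_iff) (simp add: x_coord_def y_coord_def)
qed

context conic_totally_complex
begin

section \<open>Closedness, parallelism and nondegeneracy of the induced form\<close>

lemma diff_x_coord: "c \<in> A \<Longrightarrow> p \<in> fst c \<Longrightarrow> diff_in c (x_coord i \<circ> \<phi>) p u = x_coord i (diff_in c \<phi> p u)"
  and diff_y_coord: "c \<in> A \<Longrightarrow> p \<in> fst c \<Longrightarrow> diff_in c (y_coord i \<circ> \<phi>) p u = y_coord i (diff_in c \<phi> p u)"
  by (rule diff_in_linear_phi; simp add: linear_x_coord linear_y_coord)+

lemma induced_form_eq:
  assumes "c \<in> A" "p \<in> fst c"
  shows "induced_form \<phi> c p u v = 2 * (\<Sum>i\<in>UNIV.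
      diff_in c (x_coord i \<circ> \<phi>) p u * diff_in c (y_coord i \<circ> \<phi>) p v
    - diff_in c (x_coord i \<circ> \<phi>) p v * diff_in c (y_coord i \<circ> \<phi>) p u)"
  using assms by (simp add: induced_form_def sum_dx_dy_def diff_x_coord diff_y_coord)

lemma affine_diff_linear:
  assumes "affine_fun A nabla UNIV f" "c \<in> A" "p \<in> fst c"
  shows "linear (diff_in c f p)"
  by (rule has_derivative_linear[OF diff_in_has_derivative[where D = UNIV]])
    (use affine_smooth assms in auto)

text \<open>For fields constant in the chart the bracket vanishes, so torsion-freeness makes the two
  covariant derivatives agree. As \<open>f\<close> is affine, its iterated derivatives are its
  derivatives along these covariant derivatives.\<close>

lemma second_derivative_symmetric:
  assumes f: "affine_fun A nabla UNIV f" and c: "c \<in> A" and p: "p \<in> fst c"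
  shows "diff_in c (deriv_along c (const_field c v) f) p u = diff_in c (deriv_along c (const_field c u) f) p v"
proof -
  let ?X = "const_field c u" and ?Y = "const_field c v"
  have X: "vector_field A (fst c) ?X" and Y: "vector_field A (fst c) ?Y"
    using vector_field_const[OF c open_dom[OF c]] by auto
  have p': "p \<in> fst c \<inter> fst c" using p by simp
  have const: "diff_in c (const_field c a c) p b = 0" for a b
  proof -
    have "diff_in c (const_field c a c) p = diff_in c (\<lambda>q. a) p"
      by (rule diff_in_cong[OF c open_dom[OF c] p']) (simp add: const_field_same[OF c])
    moreover have "(\<lambda>q. a) \<circ> chart_inv c = (\<lambda>x. a)" by (simp add: o_def)
    ultimately show ?thesis by (simp add: diff_in_def)
  qed
  have "field_eq A (fst c) (diff_field (diff_field (nabla ?X ?Y) (nabla ?Y ?X)) (lie_bracket ?X ?Y)) zero_field"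
    using induced X Y unfolding induced_connection_def flat_torsionfree_connection_def torsionfree_def by blast
  then have "nabla ?X ?Y c p - nabla ?Y ?X c p - lie_bracket ?X ?Y c p = 0"
    using c p unfolding field_eq_def diff_field_def zero_field_def by blast
  then have "nabla ?X ?Y c p = nabla ?Y ?X c p"
    by (simp add: lie_bracket_def const)
  then have "deriv_along c ?X (deriv_along c ?Y f) p = deriv_along c ?Y (deriv_along c ?X f) p"
    unfolding affineD[OF f X Y c p'] affineD[OF f Y X c p'] by (simp add: deriv_along_def)
  then show ?thesis
    unfolding deriv_along_def[of c _ "deriv_along _ _ _"] const_field_same[OF c p] .
qed

text \<open>One product-rule computation serves both closedness, with fields constant in a chart,
  and parallelism, with arbitrary fields.\<close>

lemma induced_form_derivative:
  assumes X: "vector_field A D X" and Y: "vector_field A D Y" and c: "c \<in> A" and p: "p \<in> D \<inter> fst c"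
  shows "diff_in c (\<lambda>q. induced_form \<phi> c q (X c q) (Y c q)) p u = 2 * (\<Sum>i\<in>UNIV.
      (deriv_along c X (x_coord i \<circ> \<phi>) p * diff_in c (deriv_along c Y (y_coord i \<circ> \<phi>)) p u
       + diff_in c (deriv_along c X (x_coord i \<circ> \<phi>)) p u * deriv_along c Y (y_coord i \<circ> \<phi>) p)
    - (deriv_along c Y (x_coord i \<circ> \<phi>) p * diff_in c (deriv_along c X (y_coord i \<circ> \<phi>)) p u
       + diff_in c (deriv_along c Y (x_coord i \<circ> \<phi>)) p u * deriv_along c X (y_coord i \<circ> \<phi>) p))"
proof -
  let ?a = "\<lambda>i. x_coord i \<circ> \<phi>" and ?b = "\<lambda>i. y_coord i \<circ> \<phi>"
  have D: "open D" using X by (simp add: vector_field_def)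
  have d: "(deriv_along c Z f \<circ> chart_inv c has_derivative diff_in c (deriv_along c Z f) p) (at (snd c p))"
    if "affine_fun A nabla UNIV f" "vector_field A D Z" for f Z
    by (rule diff_in_has_derivative[OF smooth_deriv_along[OF that c] p])
  have "((\<lambda>x. 2 * (\<Sum>i\<in>UNIV.
      (deriv_along c X (?a i) \<circ> chart_inv c) x * (deriv_along c Y (?b i) \<circ> chart_inv c) x
    - (deriv_along c Y (?a i) \<circ> chart_inv c) x * (deriv_along c X (?b i) \<circ> chart_inv c) x))
    has_derivative (\<lambda>u. 2 * (\<Sum>i\<in>UNIV.
      ((deriv_along c X (?a i) \<circ> chart_inv c) (snd c p) * diff_in c (deriv_along c Y (?b i)) p u
       + diff_in c (deriv_along c X (?a i)) p u * (deriv_along c Y (?b i) \<circ> chart_inv c) (snd c p))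
    - ((deriv_along c Y (?a i) \<circ> chart_inv c) (snd c p) * diff_in c (deriv_along c X (?b i)) p u
       + diff_in c (deriv_along c Y (?a i)) p u * (deriv_along c X (?b i) \<circ> chart_inv c) (snd c p))))) (at (snd c p))"
    by (intro has_derivative_mult_right has_derivative_sum has_derivative_diff has_derivative_mult d
        affine_coords X Y)
  then have "((\<lambda>q. induced_form \<phi> c q (X c q) (Y c q)) \<circ> chart_inv c has_derivative (\<lambda>u. 2 * (\<Sum>i\<in>UNIV.
      ((deriv_along c X (?a i) \<circ> chart_inv c) (snd c p) * diff_in c (deriv_along c Y (?b i)) p u
       + diff_in c (deriv_along c X (?a i)) p u * (deriv_along c Y (?b i) \<circ> chart_inv c) (snd c p))
    - ((deriv_along c Y (?a i) \<circ> chart_inv c) (snd c p) * diff_in c (deriv_along c X (?b i)) p u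
       + diff_in c (deriv_along c Y (?a i)) p u * (deriv_along c X (?b i) \<circ> chart_inv c) (snd c p))))) (at (snd c p))"
    by (rule has_derivative_transform_within_open[OF _ open_chart_image[OF c D]])
      (use c p in \<open>auto simp: induced_form_eq deriv_along_def\<close>)
  then have "diff_in c (\<lambda>q. induced_form \<phi> c q (X c q) (Y c q)) p = (\<lambda>u. 2 * (\<Sum>i\<in>UNIV.
      ((deriv_along c X (?a i) \<circ> chart_inv c) (snd c p) * diff_in c (deriv_along c Y (?b i)) p u
       + diff_in c (deriv_along c X (?a i)) p u * (deriv_along c Y (?b i) \<circ> chart_inv c) (snd c p))
    - ((deriv_along c Y (?a i) \<circ> chart_inv c) (snd c p) * diff_in c (deriv_along c X (?b i)) p u
       + diff_in c (deriv_along c Y (?a i)) p u * (deriv_along c X (?b i) \<circ> chart_inv c) (snd c p))))"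
    by (subst diff_in_def) (rule frechet_derivative_at[symmetric])
  then show ?thesis using c p by simp
qed

text \<open>With fields constant in the chart as arguments, every term is a product of a first and a
  second derivative of the coordinates. Second derivatives are symmetric, so the terms cancel for
  each index \<open>i\<close> separately.\<close>

lemma closed_induced_form: "closed_form A (induced_form \<phi>)"
  unfolding closed_form_def
proof (intro ballI allI)
  fix c p u v w assume c: "c \<in> A" and p: "p \<in> fst c"
  have p': "p \<in> fst c \<inter> fst c" using p by simp
  note V = vector_field_const[OF c open_dom[OF c] subset_refl]
  have eq: "diff_in c (\<lambda>q. induced_form \<phi> c q a b) p z =
      diff_in c (\<lambda>q. induced_form \<phi> c q (const_field c a c q) (const_field c b c q)) p z" for a b z
    by (subst diff_in_cong[OF c open_dom[OF c] p', where g = "\<lambda>q. induced_form \<phi> c q a b"])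
      (simp_all add: const_field_same[OF c])
  note sym = second_derivative_symmetric[OF _ c p]
  show "diff_in c (\<lambda>q. induced_form \<phi> c q v w) p u - diff_in c (\<lambda>q. induced_form \<phi> c q u w) p v
       + diff_in c (\<lambda>q. induced_form \<phi> c q u v) p w = 0"
    unfolding eq induced_form_derivative[OF V V c p'] right_diff_distrib[symmetric] distrib_left[symmetric]
      sum_subtractf[symmetric] sum.distrib[symmetric] mult_eq_0_iff
    by (intro disjI2 sum.neutral ballI)
      (simp add: sym[OF affine_coords(1), where v = w and u = v] sym[OF affine_coords(1), where v = w and u = u] sym[OF affine_coords(1), where v = v and u = u]
        sym[OF affine_coords(2), where v = w and u = v] sym[OF affine_coords(2), where v = w and u = u] sym[OF affine_coords(2), where v = v and u = u])
qed

text \<open>For affine \<open>f\<close>, differentiating \<open>X f\<close> along \<open>Z\<close>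
  gives the derivative of \<open>f\<close> along \<open>nabla Z X\<close>. The product rule
  therefore yields exactly the two terms that are subtracted.\<close>

lemma parallel_induced_form: "parallel_form A nabla (induced_form \<phi>)"
  unfolding parallel_form_def
proof (intro allI impI ballI)
  fix D X Y Z c p
  assume "vector_field A D X \<and> vector_field A D Y \<and> vector_field A D Z"
  then have X: "vector_field A D X" and Y: "vector_field A D Y" and Z: "vector_field A D Z" by auto
  assume c: "c \<in> A" and p: "p \<in> D \<inter> fst c"
  have *: "diff_in c (deriv_along c W f) p (Z c p) = deriv_along c (nabla Z W) f p"
    if "affine_fun A nabla UNIV f" "vector_field A D W" for f W
    using affineD[OF that(1) Z that(2) c p] by (simp add: deriv_along_def[of c Z])
  show "deriv_along c Z (\<lambda>q. induced_form \<phi> c q (X c q) (Y c q)) p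
      - induced_form \<phi> c p (nabla Z X c p) (Y c p) - induced_form \<phi> c p (X c p) (nabla Z Y c p) = 0"
    unfolding deriv_along_def[of c Z] induced_form_derivative[OF X Y c p]
    using c p affine_coords X Y
    by (simp add: * induced_form_eq deriv_along_def right_diff_distrib[symmetric] sum_subtractf[symmetric]
        algebra_simps)
qed

text \<open>The map is injective and linear, and its source and target have the same real
  dimension.\<close>

lemma surj_diff_F:
  assumes "c \<in> A" "p \<in> fst c" shows "surj (\<lambda>w. re_part (diff_in c \<phi> p w))"
proof -
  let ?f = "\<lambda>w. re_part (diff_in c \<phi> p w)"
  have lin: "linear ?f"
    using linear_compose[OF diff_phi_linear[OF assms] linear_re_part] by (simp add: o_def)
  have "dim (range ?f) = dim (UNIV :: (complex^'n) set)"
    using re_part_diff_phi_inj[OF assms] by (intro dim_image_eq[OF lin]) (auto intro: inj_onI)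
  also have "\<dots> = DIM((real^'n) \<times> (real^'n))" by simp
  finally have "span (range ?f) = UNIV" unfolding dim_eq_full .
  moreover have "span (range ?f) = range ?f" using linear_span_image[OF lin, of UNIV] by simp
  ultimately show ?thesis by simp
qed

lemma symplectic_induced_form: "symplectic_form A (induced_form \<phi>)"
  unfolding symplectic_form_def
proof (intro conjI closed_induced_form ballI allI impI)
  fix c p u assume c: "c \<in> A" and p: "p \<in> fst c" and "\<forall>v. induced_form \<phi> c p u v = 0"
  then have "sum_dx_dy (diff_in c \<phi> p u) (diff_in c \<phi> p v) = 0" for v
    by (simp add: induced_form_def)
  then have "re_part (diff_in c \<phi> p u) = re_part 0"
    by (rule sum_dx_dy_nondegenerate) (rule surj_diff_F[OF c p])
  then show "u = 0"
    using re_part_diff_phi_inj[OF c p, of u 0] linear_0[OF diff_phi_linear[OF c p]] by simp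
next
  show "two_form A (induced_form \<phi>)"
    unfolding two_form_def
  proof (intro conjI ballI allI)
    fix c p u v assume c: "c \<in> A" and p: "p \<in> fst c"
    note lin = diff_phi_linear[OF c p]
    show swap: "induced_form \<phi> c p u v = - induced_form \<phi> c p v u" for u v
      using sum_dx_dy_swap[of "diff_in c \<phi> p u" "diff_in c \<phi> p v"] by (simp add: induced_form_def)
    show r: "linear (induced_form \<phi> c p u)" for u
      by (rule linearI) (simp_all add: induced_form_def linear_add[OF lin] linear_cmul[OF lin]
          sum_dx_dy_add_right sum_dx_dy_scaleR_right algebra_simps)
    show "linear (\<lambda>u. induced_form \<phi> c p u v)"
      using linear_compose_neg[OF r[of v]] by (subst swap)
  next
    fix c u v assume c: "c \<in> A"
    have *: "smooth_on (snd c ` fst c) (\<lambda>x. frechet_derivative (f \<circ> chart_inv c) (at x) z)"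
      if "affine_fun A nabla UNIV f" for f z
      by (rule smooth_on_derivative[OF affine_smooth[OF that c]])
    have "smooth_on (snd c ` fst c) (\<lambda>x. 2 * (\<Sum>i\<in>UNIV.
        frechet_derivative (x_coord i \<circ> \<phi> \<circ> chart_inv c) (at x) u * frechet_derivative (y_coord i \<circ> \<phi> \<circ> chart_inv c) (at x) v
      - frechet_derivative (x_coord i \<circ> \<phi> \<circ> chart_inv c) (at x) v * frechet_derivative (y_coord i \<circ> \<phi> \<circ> chart_inv c) (at x) u))"
      by (intro smooth_on_mult smooth_on_const smooth_on_sum smooth_on_diff * affine_coords open_ran c)
    then show "smooth_on (snd c ` fst c) (\<lambda>x. induced_form \<phi> c (chart_inv c x) u v)"
      by (rule smooth_on_cong) (use c in \<open>auto simp: induced_form_eq diff_in_def\<close>)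
  next
    fix c c' p u v assume c: "c \<in> A" "c' \<in> A" and p: "p \<in> fst c \<inter> fst c'"
    have "(\<phi> \<circ> chart_inv c') differentiable (at (snd c' p))"
      using phi_has_derivative(1) c p differentiable_def by blast
    then have "diff_in c \<phi> p z = diff_in c' \<phi> p (diff_in c (snd c') p z)" for z
      using c p by (intro diff_in_change_chart) auto
    then show "induced_form \<phi> c p u v = induced_form \<phi> c' p (diff_in c (snd c') p u) (diff_in c (snd c') p v)"
      by (simp add: induced_form_def)
  qed
qed

section \<open>Parallel fields in affine coordinates\<close>

lemma parallel_derivative_locally_constant:
  assumes X: "parallel_field A nabla D X" and f: "affine_fun A nabla UNIV f" and c: "c \<in> A"
    and p: "p \<in> D \<inter> fst c"
  obtains U where "open U" "p \<in> U" "U \<subseteq> D \<inter> fst c"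
    "\<And>q. q \<in> U \<Longrightarrow> deriv_along c X f q = deriv_along c X f p"
proof -
  let ?S = "snd c ` (D \<inter> fst c)" and ?g = "deriv_along c X f \<circ> chart_inv c"
  have XD: "vector_field A D X" using X by (simp add: parallel_field_def)
  then have D: "open D" by (simp add: vector_field_def)
  have E: "open (D \<inter> fst c)" using D open_dom[OF c] by (rule open_Int)
  \<comment> \<open>Every direction \<open>u\<close> is realised by a field constant in the chart.
    Along it, \<open>X f\<close> changes by the derivative of \<open>f\<close> along
    \<open>nabla ?Y X\<close>, which vanishes since \<open>X\<close> is parallel.\<close>
  have zero: "diff_in c (deriv_along c X f) q u = 0" if q: "q \<in> D \<inter> fst c" for q u
  proof -
    let ?Y = "const_field c u"
    have Y: "vector_field A (D \<inter> fst c) ?Y" by (rule vector_field_const[OF c E]) simp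
    have "field_eq A (D \<inter> fst c) (nabla ?Y X) zero_field"
      using X Y by (simp add: parallel_field_def)
    then have n: "nabla ?Y X c q = 0" using c q by (simp add: field_eq_def zero_field_def)
    have "deriv_along c ?Y (deriv_along c X f) q = deriv_along c (nabla ?Y X) f q"
      by (rule affineD[OF f Y vector_field_subset[OF XD E] c]) (use q in auto)
    also have "\<dots> = 0"
      using n q linear_0[OF affine_diff_linear[OF f c]] by (simp add: deriv_along_def)
    finally show ?thesis using q by (simp add: deriv_along_def[of c ?Y] const_field_same[OF c])
  qed
  have d: "(?g has_derivative (\<lambda>h. 0)) (at x)" if x: "x \<in> ?S" for x
  proof -
    obtain q where q: "q \<in> D \<inter> fst c" "x = snd c q" using x by blast
    have "diff_in c (deriv_along c X f) q = (\<lambda>h. 0)" using zero[OF q(1)] by (simp add: fun_eq_iff)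
    then show ?thesis
      using diff_in_has_derivative[OF smooth_deriv_along[OF f XD c] q(1)] unfolding q(2) by (simp only:)
  qed
  obtain r where r: "r > 0" "ball (snd c p) r \<subseteq> ?S"
    by (rule openE[OF open_chart_image[OF c D], of "snd c p"]) (use p in auto)
  have "(?g has_derivative (\<lambda>h. 0)) (at x within ball (snd c p) r)" if "x \<in> ball (snd c p) r" for x
    by (rule has_derivative_at_withinI[OF d[OF subsetD[OF r(2) that]]])
  from has_derivative_zero_constant[OF convex_ball this]
  obtain k where k: "\<And>x. x \<in> ball (snd c p) r \<Longrightarrow> ?g x = k"
    by auto
  define U where "U = (D \<inter> fst c) \<inter> snd c -` ball (snd c p) r"
  show thesis
  proof
    show "open U" unfolding U_def
      by (rule continuous_open_preimage[OF continuous_on_subset[OF chart_continuous[OF c]] E]) auto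
    show "p \<in> U" "U \<subseteq> D \<inter> fst c" using p r(1) by (auto simp: U_def)
    have U: "deriv_along c X f q = k" if "q \<in> U" for q
    proof -
      have "q \<in> fst c" "snd c q \<in> ball (snd c p) r" using that unfolding U_def by blast+
      then show ?thesis using k[of "snd c q"] chart_inv_left[OF c] by simp
    qed
    show "deriv_along c X f q = deriv_along c X f p" if "q \<in> U" for q
      using U[OF that] U[OF \<open>p \<in> U\<close>] by simp
  qed
qed

text \<open>Local constancy propagates over the connected set \<open>D\<close>. Applied to all
  coordinates, this shows that the image of a parallel field under the differential of
  \<open>\<phi>\<close> has the same real part at all points of \<open>D\<close>.\<close>

lemma parallel_derivative_constant:
  assumes X: "parallel_field A nabla D X" and f: "affine_fun A nabla UNIV f" and D: "connected D"
    and c: "c \<in> A" "p \<in> D \<inter> fst c" and c': "c' \<in> A" "q \<in> D \<inter> fst c'"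
  shows "deriv_along c X f p = deriv_along c' X f q"
proof -
  have XD: "vector_field A D X" using X by (simp add: parallel_field_def)
  have indep: "deriv_along c X f p = deriv_along c' X f p"
    if "c \<in> A" "c' \<in> A" "p \<in> D" "p \<in> fst c" "p \<in> fst c'" for c c' p
  proof -
    have "(f \<circ> chart_inv c') differentiable (at (snd c' p))"
      by (rule smooth_on_imp_differentiable[OF affine_smooth[OF f that(2)] imageI[OF that(5)]])
    then have "diff_in c f p (X c p) = diff_in c' f p (diff_in c (snd c') p (X c p))"
      by (rule diff_in_change_chart[OF that(1,2,4,5)])
    moreover have "X c' p = diff_in c (snd c') p (X c p)"
      using XD that unfolding vector_field_def by blast
    ultimately show ?thesis by (simp only: deriv_along_def)
  qed
  \<comment> \<open>A chart is chosen at each point to obtain a single function on \<open>D\<close>;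
    by \<open>indep\<close> the choice does not affect the value.\<close>
  define k where "k p = deriv_along (SOME c. c \<in> A \<and> p \<in> fst c) X f p" for p
  have k: "k p = deriv_along c X f p" if "c \<in> A" "p \<in> D \<inter> fst c" for c p
  proof -
    have "(SOME c. c \<in> A \<and> p \<in> fst c) \<in> A \<and> p \<in> fst (SOME c. c \<in> A \<and> p \<in> fst c)"
      by (rule someI[of _ c]) (use that in auto)
    then show ?thesis unfolding k_def using that by (intro indep) simp_all
  qed
  have "k p = k q"
  proof (rule connected_local_const[OF D])
    show "\<forall>a\<in>D. \<forall>\<^sub>F b in at a within D. k a = k b"
    proof
      fix a assume a: "a \<in> D"
      obtain e where e: "e \<in> A" "a \<in> fst e" by (rule chart_exists)
      obtain U where U: "open U" "a \<in> U" "U \<subseteq> D \<inter> fst e"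
        "\<And>q. q \<in> U \<Longrightarrow> deriv_along e X f q = deriv_along e X f a"
        by (rule parallel_derivative_locally_constant[OF X f e(1) IntI[OF a e(2)]]) blast
      have "k a = k b" if "b \<in> U" for b
        using U(4)[OF that] U(2,3) that k[OF e(1), of a] k[OF e(1), of b] by (metis subsetD)
      then show "\<forall>\<^sub>F b in at a within D. k a = k b"
        using U(1,2) unfolding eventually_at_topological by blast
    qed
  qed (use c c' in auto)
  then show ?thesis using k[OF c] k[OF c'] by simp
qed

end

subsection \<open>The local action\<close>

lemma smooth_on_ident: assumes "open S" shows "smooth_on S (\<lambda>x. x)"
proof -
  have "Ck_on k S (\<lambda>x. x)" for k
  proof (cases k)
    case (Suc j)
    then show ?thesis
      using Ck_on_SucI[OF assms has_derivative_ident Ck_on_const[OF assms]] by simp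
  qed simp
  then show ?thesis using assms by (simp add: smooth_on_def)
qed

section \<open>Local inversion of the real part and unique lifting of paths\<close>

context conic_totally_complex
begin

text \<open>The injective differential makes \<open>F\<close> injective on a small ball of a chart,
  and invariance of domain makes the image open and the inverse continuous. Smoothness of the
  inverse comes later from \<open>smooth_on_lift\<close>.\<close>

lemma F_local:
  obtains U where "open U" "p \<in> U" "open (F ` U)" "homeomorphism U (F ` U) F (inv_into U F)"
proof -
  obtain c where c: "c \<in> A" "p \<in> fst c" by (rule chart_exists)
  let ?G = "F \<circ> chart_inv c"
  obtain r where r: "r > 0" "ball (snd c p) r \<subseteq> snd c ` fst c" "inj_on ?G (ball (snd c p) r)"
    using smooth_on_locally_injective[OF smooth_F[OF c(1)] _ inj_derivative_F[OF c(1)]] c(2)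
    by (metis imageI)
  let ?B = "ball (snd c p) r"
  define U where "U = fst c \<inter> snd c -` ?B"
  have U: "open U" unfolding U_def
    by (rule continuous_open_preimage[OF chart_continuous open_dom]) (use c in auto)
  have img: "chart_inv c ` ?B = U"
  proof (intro set_eqI iffI)
    fix q assume "q \<in> chart_inv c ` ?B"
    then obtain x where x: "x \<in> ?B" "q = chart_inv c x" by blast
    then obtain q' where "q' \<in> fst c" "x = snd c q'" using r(2) by blast
    then show "q \<in> U" using x c(1) by (simp add: U_def)
  next
    fix q assume "q \<in> U"
    then have "q = chart_inv c (snd c q)" "snd c q \<in> ?B" using c(1) by (simp_all add: U_def)
    then show "q \<in> chart_inv c ` ?B" by (rule image_eqI)
  qed
  have F_inj: "inj_on F U"
    using r(3) unfolding img[symmetric] by (rule inj_on_imageI)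
  have FU: "F ` U = ?G ` ?B" by (simp add: img[symmetric] image_comp)
  have G: "continuous_on ?B ?G"
    by (intro continuous_on_compose continuous_on_subset[OF chart_inv_continuous[OF c(1)] r(2)] F_continuous)
  have dim: "DIM((real^'n) \<times> (real^'n)) \<le> DIM(complex^'n)" by simp
  have oFU: "open (F ` U)"
    unfolding FU by (rule invariance_of_domain_gen[OF open_ball G r(3) dim])
  \<comment> \<open>Continuity of the inverse is proved in chart coordinates, where invariance of
    domain applies, and then carried to the manifold by \<open>chart_inv c\<close>.\<close>
  have "continuous_on (?G ` ?B) (snd c \<circ> inv_into U F)"
  proof (rule continuous_on_inverse_open[OF open_ball G dim])
    fix x assume x: "x \<in> ?B"
    then have "chart_inv c x \<in> U" using img by blast
    moreover obtain q where "q \<in> fst c" "x = snd c q" using r(2) x by blast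
    ultimately show "(snd c \<circ> inv_into U F) (?G x) = x"
      using F_inj c(1) by simp
  qed
  then have "continuous_on (F ` U) (snd c \<circ> inv_into U F)" by (simp only: FU)
  moreover have "(snd c \<circ> inv_into U F) ` (F ` U) \<subseteq> snd c ` fst c"
    using F_inj by (auto simp: U_def)
  ultimately have "continuous_on (F ` U) (\<lambda>y. chart_inv c ((snd c \<circ> inv_into U F) y))"
    by (rule continuous_on_compose2[OF chart_inv_continuous[OF c(1)]])
  moreover have "chart_inv c ((snd c \<circ> inv_into U F) y) = inv_into U F y" if "y \<in> F ` U" for y
    using inv_into_into[OF that] c(1) by (simp add: U_def)
  ultimately have "continuous_on (F ` U) (inv_into U F)"
    by (rule continuous_on_eq)
  then have "homeomorphism U (F ` U) F (inv_into U F)"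
    using F_inj F_continuous[of U] by (auto simp: homeomorphism_def)
  then show thesis
    by (intro that[OF U _ oFU]) (use c(2) r(1) in \<open>simp_all add: U_def\<close>)
qed

text \<open>\<open>F\<close> is a function of \<open>\<phi>\<close>, so points with equal
  \<open>\<phi>\<close> have equal \<open>F\<close>.\<close>

lemma phi_locally_injective: obtains U where "open U" "p \<in> U" "inj_on \<phi> U"
proof -
  obtain U where U: "open U" "p \<in> U" "homeomorphism U (F ` U) F (inv_into U F)" by (rule F_local)
  have "inj_on \<phi> U"
  proof (rule inj_onI)
    fix a b assume a: "a \<in> U" and b: "b \<in> U" and eq: "\<phi> a = \<phi> b"
    have "a = inv_into U F (F a)" by (rule homeomorphism_apply1[OF U(3) a, symmetric])
    also have "F a = F b" using eq by (simp add: F_def)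
    also have "inv_into U F (F b) = b" by (rule homeomorphism_apply1[OF U(3) b])
    finally show "a = b" .
  qed
  with U that show thesis by blast
qed

text \<open>The times of agreement form an open and closed set: agreement persists nearby because
  \<open>\<phi>\<close> is locally injective, disagreement because the manifold is
  Hausdorff.\<close>

lemma lift_unique:
  fixes \<alpha> \<beta> :: "real \<Rightarrow> 'm"
  assumes \<alpha>: "continuous_on {0..1} \<alpha>" and \<beta>: "continuous_on {0..1} \<beta>"
    and eq: "\<And>t. t \<in> {0..1} \<Longrightarrow> \<phi> (\<alpha> t) = \<phi> (\<beta> t)" and start: "\<alpha> 0 = \<beta> 0"
  shows "\<alpha> 1 = \<beta> 1"
proof -
  \<comment> \<open>The truth value of agreement is treated as a locally constant function on the
    interval.\<close>
  have "(\<alpha> 0 = \<beta> 0) = (\<alpha> 1 = \<beta> 1)"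
  proof (rule connected_local_const[of "{0..1}"])
    show "\<forall>a\<in>{0..1}. \<forall>\<^sub>F b in at a within {0..1}. (\<alpha> a = \<beta> a) = (\<alpha> b = \<beta> b)"
    proof
      fix a :: real assume a: "a \<in> {0..1}"
      have t: "(\<alpha> \<longlongrightarrow> \<alpha> a) (at a within {0..1})" "(\<beta> \<longlongrightarrow> \<beta> a) (at a within {0..1})"
        using \<alpha> \<beta> a unfolding continuous_on_def by blast+
      have I: "\<forall>\<^sub>F b in at a within {0..1}. b \<in> {0..1}" by (simp add: eventually_at_filter)
      have 1: "\<forall>\<^sub>F b in at a within {0..1}. \<alpha> b = \<beta> b" if ab: "\<alpha> a = \<beta> a"
      proof -
        obtain U where U: "open U" "\<alpha> a \<in> U" "inj_on \<phi> U" by (rule phi_locally_injective[of "\<alpha> a"])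
        have U': "\<beta> a \<in> U" using U(2) by (simp only: ab)
        show ?thesis
          using topological_tendstoD[OF t(1) U(1,2)] topological_tendstoD[OF t(2) U(1) U'] I
          by eventually_elim (rule inj_onD[OF U(3) eq])
      qed
      have 2: "\<forall>\<^sub>F b in at a within {0..1}. \<alpha> b \<noteq> \<beta> b" if ab: "\<alpha> a \<noteq> \<beta> a"
      proof -
        obtain M N where MN: "open M" "open N" "\<alpha> a \<in> M" "\<beta> a \<in> N" "M \<inter> N = {}"
          using hausdorff[OF ab] by (elim exE conjE) (rule that)
        show ?thesis
          using topological_tendstoD[OF t(1) MN(1,3)] topological_tendstoD[OF t(2) MN(2,4)]
        proof eventually_elim
          case (elim b)
          show ?case
          proof
            assume "\<alpha> b = \<beta> b"
            with elim have "\<beta> b \<in> M \<inter> N" by (simp only: Int_iff)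
            then show False by (simp only: MN(5) empty_iff)
          qed
        qed
      qed
      show "\<forall>\<^sub>F b in at a within {0..1}. (\<alpha> a = \<beta> a) = (\<alpha> b = \<beta> b)"
      proof (cases "\<alpha> a = \<beta> a")
        case True
        show ?thesis by (rule eventually_mono[OF 1[OF True]]) (simp add: True)
      next
        case False
        show ?thesis by (rule eventually_mono[OF 2[OF False]]) (simp add: False)
      qed
    qed
  qed (simp_all)
  with start show ?thesis by simp
qed

section \<open>Local flows lifting scalar multiplication\<close>

definition local_flow :: "real \<Rightarrow> 'm set \<Rightarrow> (complex \<Rightarrow> 'm \<Rightarrow> 'm) \<Rightarrow> bool" where
  "local_flow \<epsilon> U \<Psi> \<longleftrightarrow> open U \<and> 0 < \<epsilon> \<and> \<epsilon> \<le> 1 \<and>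
    continuous_on (ball 1 \<epsilon> \<times> U) (\<lambda>(l, p). \<Psi> l p) \<and> (\<forall>p\<in>U. \<Psi> 1 p = p) \<and>
    (\<forall>l\<in>ball 1 \<epsilon>. \<forall>p\<in>U. \<phi> (\<Psi> l p) = scale_V l (\<phi> p))"

text \<open>The conic condition places nearby multiples of \<open>\<phi> q\<close> in the image of a
  set \<open>V\<close> on which \<open>F\<close> has a continuous inverse; the lift is recovered
  from the real part alone.\<close>

lemma local_flow_exists: obtains \<epsilon> U \<Psi> where "local_flow \<epsilon> U \<Psi>" "p \<in> U"
proof -
  obtain V where V: "open V" "p \<in> V" "homeomorphism V (F ` V) F (inv_into V F)" by (rule F_local)
  obtain U1 Up where U1: "open U1" "1 \<in> U1" and Up: "open Up" "p \<in> Up"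
    and sub: "\<And>l. l \<in> U1 \<Longrightarrow> scale_V l ` \<phi> ` Up \<subseteq> \<phi> ` V"
    using conic V(1,2) unfolding conic_immersion_def by meson
  obtain r where r: "r > 0" "ball 1 r \<subseteq> U1" using U1 openE by metis
  \<comment> \<open>The bound \<open>1\<close> keeps \<open>0\<close> out of the open disc around
    \<open>1\<close>, so that only nonzero scalars act.\<close>
  define \<epsilon> where "\<epsilon> = min r 1"
  define \<Psi> where "\<Psi> l q = inv_into V F (re_part (scale_V l (\<phi> q)))" for l q
  have \<epsilon>: "ball 1 \<epsilon> \<subseteq> U1" "0 < \<epsilon>" "\<epsilon> \<le> 1" using r by (auto simp: \<epsilon>_def)
  have inv: "inv_into V F (F s) = s" if "s \<in> V" for s
    using V(3) that by (rule homeomorphism_apply1)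
  have lift: "scale_V l (\<phi> q) \<in> \<phi> ` V" if "l \<in> ball 1 \<epsilon>" "q \<in> Up \<inter> V" for l q
    using sub[of l] that \<epsilon>(1) by blast
  have "\<phi> (\<Psi> l q) = scale_V l (\<phi> q)" if lq: "l \<in> ball 1 \<epsilon>" "q \<in> Up \<inter> V" for l q
  proof -
    obtain s where s: "s \<in> V" "scale_V l (\<phi> q) = \<phi> s" using lift[OF lq] by blast
    then have "\<Psi> l q = s" using inv[OF s(1)] by (simp add: \<Psi>_def F_def)
    with s show ?thesis by simp
  qed
  moreover have "\<Psi> 1 q = q" if "q \<in> Up \<inter> V" for q
    using inv[of q] that by (simp add: \<Psi>_def scale_V_simps F_def)
  moreover have "continuous_on (ball 1 \<epsilon> \<times> (Up \<inter> V)) (\<lambda>(l, q). \<Psi> l q)"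
    unfolding \<Psi>_def case_prod_unfold
  proof (rule continuous_on_compose2[where g = "inv_into V F" and f = "\<lambda>z. re_part (scale_V (fst z) (\<phi> (snd z)))"])
    show "continuous_on (F ` V) (inv_into V F)" using V(3) by (simp add: homeomorphism_def)
    show "continuous_on (ball 1 \<epsilon> \<times> (Up \<inter> V)) (\<lambda>z. re_part (scale_V (fst z) (\<phi> (snd z))))"
      by (intro bounded_linear.continuous_on[OF linear_re_part[unfolded linear_conv_bounded_linear]]
          bounded_bilinear.continuous_on[OF bilinear_scale_V] continuous_on_fst continuous_on_id
          continuous_on_compose2[OF phi_continuous continuous_on_snd[OF continuous_on_id]] subset_UNIV)
    show "(\<lambda>z. re_part (scale_V (fst z) (\<phi> (snd z)))) ` (ball 1 \<epsilon> \<times> (Up \<inter> V)) \<subseteq> F ` V"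
    proof
      fix y assume "y \<in> (\<lambda>z. re_part (scale_V (fst z) (\<phi> (snd z)))) ` (ball 1 \<epsilon> \<times> (Up \<inter> V))"
      then obtain l q where lq: "l \<in> ball 1 \<epsilon>" "q \<in> Up \<inter> V" "y = re_part (scale_V l (\<phi> q))" by force
      then obtain s where "s \<in> V" "scale_V l (\<phi> q) = \<phi> s" using lift[OF lq(1,2)] by blast
      with lq show "y \<in> F ` V" by (simp add: F_def)
    qed
  qed
  moreover have "open (Up \<inter> V)" using Up(1) V(1) by (rule open_Int)
  ultimately have "local_flow \<epsilon> (Up \<inter> V) \<Psi>"
    unfolding local_flow_def using \<epsilon>(2,3) by blast
  then show thesis using that Up(2) V(2) by blast
qed

text \<open>Discs are convex, so the segment from \<open>m\<close> to \<open>n\<close> consists of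
  admissible scalars; such segments supply the paths for \<open>lift_unique\<close>.\<close>

lemma local_flow_path:
  assumes flow: "local_flow \<epsilon> U \<Psi>" and p: "p \<in> U" and m: "m \<in> ball 1 \<epsilon>" and n: "n \<in> ball 1 \<epsilon>"
  shows "continuous_on {0..1} (\<lambda>t. \<Psi> ((1 - t) *\<^sub>R m + t *\<^sub>R n) p)"
    and "t \<in> {0..1} \<Longrightarrow> \<phi> (\<Psi> ((1 - t) *\<^sub>R m + t *\<^sub>R n) p) = scale_V ((1 - t) *\<^sub>R m + t *\<^sub>R n) (\<phi> p)"
proof -
  have *: "(1 - t) *\<^sub>R m + t *\<^sub>R n \<in> ball 1 \<epsilon>" if "t \<in> {0..1}" for t
    using convexD[OF convex_ball m n, of "1 - t" t] that by simp
  have "continuous_on {0..1} (\<lambda>t. (\<lambda>(l, p). \<Psi> l p) ((1 - t) *\<^sub>R m + t *\<^sub>R n, p))"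
    by (rule continuous_on_compose2[where t = "ball 1 \<epsilon> \<times> U"])
      (use flow p * in \<open>auto simp: local_flow_def intro!: continuous_intros\<close>)
  then show "continuous_on {0..1} (\<lambda>t. \<Psi> ((1 - t) *\<^sub>R m + t *\<^sub>R n) p)" by simp
  show "t \<in> {0..1} \<Longrightarrow> \<phi> (\<Psi> ((1 - t) *\<^sub>R m + t *\<^sub>R n) p) = scale_V ((1 - t) *\<^sub>R m + t *\<^sub>R n) (\<phi> p)"
    using flow p *[of t] unfolding local_flow_def by blast
qed

text \<open>Multiplication by \<open>m\<close> takes the segment from \<open>1\<close> to
  \<open>l\<close> to the segment from \<open>m\<close> to \<open>l * m\<close>. Following
  \<open>\<Psi>'\<close> along the first, starting at \<open>\<Psi> m p\<close>, and
  \<open>\<Psi>\<close> along the second gives two lifts of one path with the same start.\<close>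

lemma local_flow_compose:
  assumes flow: "local_flow \<epsilon> U \<Psi>" and p: "p \<in> U" and m: "m \<in> ball 1 \<epsilon>" "l * m \<in> ball 1 \<epsilon>"
    and flow': "local_flow \<epsilon>' U' \<Psi>'" and q: "\<Psi> m p \<in> U'" and l: "l \<in> ball 1 \<epsilon>'"
  shows "\<Psi>' l (\<Psi> m p) = \<Psi> (l * m) p"
proof -
  have one: "1 \<in> ball (1::complex) \<epsilon>'" using flow' by (simp add: local_flow_def)
  have comb: "((1 - t) *\<^sub>R 1 + t *\<^sub>R l) * m = (1 - t) *\<^sub>R m + t *\<^sub>R (l * m)" for t :: real
    by (simp add: algebra_simps)
  have "\<Psi>' ((1 - 1) *\<^sub>R 1 + 1 *\<^sub>R l) (\<Psi> m p) = \<Psi> ((1 - 1) *\<^sub>R m + 1 *\<^sub>R (l * m)) p"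
  proof (rule lift_unique[where \<alpha> = "\<lambda>t. \<Psi>' ((1 - t) *\<^sub>R 1 + t *\<^sub>R l) (\<Psi> m p)"
        and \<beta> = "\<lambda>t. \<Psi> ((1 - t) *\<^sub>R m + t *\<^sub>R (l * m)) p"])
    show "continuous_on {0..1} (\<lambda>t. \<Psi>' ((1 - t) *\<^sub>R 1 + t *\<^sub>R l) (\<Psi> m p))"
      by (rule local_flow_path(1)[OF flow' q one l])
    show "continuous_on {0..1} (\<lambda>t. \<Psi> ((1 - t) *\<^sub>R m + t *\<^sub>R (l * m)) p)"
      by (rule local_flow_path(1)[OF flow p m])
    fix t :: real assume t: "t \<in> {0..1}"
    have "\<phi> (\<Psi> m p) = scale_V m (\<phi> p)" using flow p m(1) unfolding local_flow_def by blast
    then show "\<phi> (\<Psi>' ((1 - t) *\<^sub>R 1 + t *\<^sub>R l) (\<Psi> m p)) = \<phi> (\<Psi> ((1 - t) *\<^sub>R m + t *\<^sub>R (l * m)) p)"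
      unfolding local_flow_path(2)[OF flow' q one l t] local_flow_path(2)[OF flow p m t]
      by (simp only: scale_V_simps(1) comb)
  next
    show "\<Psi>' ((1 - 0) *\<^sub>R 1 + 0 *\<^sub>R l) (\<Psi> m p) = \<Psi> ((1 - 0) *\<^sub>R m + 0 *\<^sub>R (l * m)) p"
      using flow' q by (simp add: local_flow_def)
  qed
  then show ?thesis by simp
qed

section \<open>Gluing the local flows to an action\<close>

definition W :: "(complex \<times> 'm) set" where
  "W = {(l, p). \<exists>\<epsilon> U \<Psi>. local_flow \<epsilon> U \<Psi> \<and> l \<in> ball 1 \<epsilon> \<and> p \<in> U}"

text \<open>The value is chosen among those of all local flows defined at \<open>(l, p)\<close>;
  \<open>act_eq\<close> shows that there is only one candidate. Outside \<open>W\<close> it is an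
  arbitrary default.\<close>

definition act :: "complex \<Rightarrow> 'm \<Rightarrow> 'm" where
  "act l p = (SOME q. \<exists>\<epsilon> U \<Psi>. local_flow \<epsilon> U \<Psi> \<and> l \<in> ball 1 \<epsilon> \<and> p \<in> U \<and> q = \<Psi> l p)"

lemma W_cases:
  assumes "(l, p) \<in> W"
  obtains \<epsilon> U \<Psi> where "local_flow \<epsilon> U \<Psi>" "l \<in> ball 1 \<epsilon>" "p \<in> U"
  using assms unfolding W_def by blast

lemma local_flow_subset_W: "local_flow \<epsilon> U \<Psi> \<Longrightarrow> ball 1 \<epsilon> \<times> U \<subseteq> W"
  unfolding W_def by blast

text \<open>\<open>local_flow_compose\<close> with first scalar \<open>1\<close>, which acts as the
  identity, identifies the values of any two local flows.\<close>

lemma act_eq: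
  assumes flow: "local_flow \<epsilon> U \<Psi>" and l: "l \<in> ball 1 \<epsilon>" and p: "p \<in> U"
  shows "act l p = \<Psi> l p"
  unfolding act_def
proof (rule some_equality)
  show "\<exists>\<epsilon> U \<Psi>'. local_flow \<epsilon> U \<Psi>' \<and> l \<in> ball 1 \<epsilon> \<and> p \<in> U \<and> \<Psi> l p = \<Psi>' l p"
    using assms by blast
next
  fix q assume "\<exists>\<epsilon> U \<Psi>. local_flow \<epsilon> U \<Psi> \<and> l \<in> ball 1 \<epsilon> \<and> p \<in> U \<and> q = \<Psi> l p"
  then obtain \<epsilon>' U' \<Psi>' where flow': "local_flow \<epsilon>' U' \<Psi>'" "l \<in> ball 1 \<epsilon>'" "p \<in> U'" "q = \<Psi>' l p"
    by blast
  have 1: "\<Psi> 1 p = p" "1 \<in> ball (1::complex) \<epsilon>" using flow p by (auto simp: local_flow_def)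
  have "\<Psi>' l (\<Psi> 1 p) = \<Psi> (l * 1) p"
    by (rule local_flow_compose[OF flow p _ _ flow'(1)]) (use 1 l flow' in simp_all)
  then show "q = \<Psi> l p" using 1 flow' by simp
qed

lemma open_W: "open W"
proof (rule Topological_Spaces.openI)
  fix z assume "z \<in> W"
  then obtain l p where z: "z = (l, p)" "(l, p) \<in> W" by (cases z) auto
  obtain \<epsilon> U \<Psi> where f: "local_flow \<epsilon> U \<Psi>" "l \<in> ball 1 \<epsilon>" "p \<in> U" using z(2) by (rule W_cases)
  have "open (ball 1 \<epsilon> \<times> U)" using f(1) by (intro open_Times open_ball) (simp add: local_flow_def)
  then show "\<exists>T. open T \<and> z \<in> T \<and> T \<subseteq> W"
    using local_flow_subset_W[OF f(1)] f z by blast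
qed

lemma act_continuous: "continuous_on W (\<lambda>(l, p). act l p)"
proof (rule continuous_at_imp_continuous_on, rule ballI)
  fix z assume "z \<in> W"
  then obtain l p where z: "z = (l, p)" "(l, p) \<in> W" by (cases z) auto
  obtain \<epsilon> U \<Psi> where f: "local_flow \<epsilon> U \<Psi>" "l \<in> ball 1 \<epsilon>" "p \<in> U" using z(2) by (rule W_cases)
  have "continuous_on (ball 1 \<epsilon> \<times> U) (\<lambda>(l, p). \<Psi> l p)" using f(1) by (simp add: local_flow_def)
  moreover have "(\<lambda>(l, p). \<Psi> l p) y = (\<lambda>(l, p). act l p) y" if "y \<in> ball 1 \<epsilon> \<times> U" for y
    using that act_eq[OF f(1)] by force
  ultimately have "continuous_on (ball 1 \<epsilon> \<times> U) (\<lambda>(l, p). act l p)"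
    by (rule continuous_on_eq)
  moreover have "open (ball 1 \<epsilon> \<times> U)" using f(1) by (intro open_Times open_ball) (simp add: local_flow_def)
  moreover have "z \<in> ball 1 \<epsilon> \<times> U" using f z by blast
  ultimately show "isCont (\<lambda>(l, p). act l p) z" using continuous_on_eq_continuous_at by blast
qed

lemma phi_act: assumes "(l, p) \<in> W" shows "\<phi> (act l p) = scale_V l (\<phi> p)"
proof -
  obtain \<epsilon> U \<Psi> where f: "local_flow \<epsilon> U \<Psi>" "l \<in> ball 1 \<epsilon>" "p \<in> U" using assms by (rule W_cases)
  then have "\<phi> (\<Psi> l p) = scale_V l (\<phi> p)" unfolding local_flow_def by blast
  then show ?thesis using act_eq[OF f] by simp
qed

lemma W_nonzero: assumes "(l, p) \<in> W" shows "l \<noteq> 0"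
proof
  assume "l = 0"
  obtain \<epsilon> U \<Psi> where "local_flow \<epsilon> U \<Psi>" "l \<in> ball 1 \<epsilon>" using assms by (rule W_cases)
  with \<open>l = 0\<close> show False by (simp add: local_flow_def)
qed

lemma one_W: "(1, p) \<in> W" and act_one: "act 1 p = p"
proof -
  obtain \<epsilon> U \<Psi> where f: "local_flow \<epsilon> U \<Psi>" "p \<in> U" by (rule local_flow_exists)
  then have 1: "1 \<in> ball (1::complex) \<epsilon>" "\<Psi> 1 p = p" by (auto simp: local_flow_def)
  then show "(1, p) \<in> W" using local_flow_subset_W[OF f(1)] f by blast
  show "act 1 p = p" using act_eq[OF f(1) 1(1) f(2)] 1 by simp
qed

lemma act_act:
  assumes m: "(m, p) \<in> W" and l: "(l, act m p) \<in> W" and lm: "(l * m, p) \<in> W"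
  shows "act l (act m p) = act (l * m) p"
proof -
  obtain \<epsilon>1 U1 \<Psi>1 where f1: "local_flow \<epsilon>1 U1 \<Psi>1" "m \<in> ball 1 \<epsilon>1" "p \<in> U1" using m by (rule W_cases)
  obtain \<epsilon>2 U2 \<Psi>2 where f2: "local_flow \<epsilon>2 U2 \<Psi>2" "l * m \<in> ball 1 \<epsilon>2" "p \<in> U2" using lm by (rule W_cases)
  \<comment> \<open>The discs are concentric, so the larger one contains both \<open>m\<close> and
    \<open>l * m\<close>; as \<open>p\<close> lies in the domains of both flows, one flow handles
    both scalars.\<close>
  obtain \<epsilon> U \<Psi> where f: "local_flow \<epsilon> U \<Psi>" "m \<in> ball 1 \<epsilon>" "l * m \<in> ball 1 \<epsilon>" "p \<in> U"
  proof (cases "\<epsilon>1 \<le> \<epsilon>2")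
    case True
    then have "m \<in> ball 1 \<epsilon>2" using f1(2) by simp
    then show thesis by (rule that[OF f2(1) _ f2(2,3)])
  next
    case False
    then have "l * m \<in> ball 1 \<epsilon>1" using f2(2) by simp
    then show thesis by (rule that[OF f1(1,2) _ f1(3)])
  qed
  obtain \<epsilon>' U' \<Psi>' where f': "local_flow \<epsilon>' U' \<Psi>'" "l \<in> ball 1 \<epsilon>'" "act m p \<in> U'" using l by (rule W_cases)
  have am: "act m p = \<Psi> m p" by (rule act_eq[OF f(1,2,4)])
  have "act l (act m p) = \<Psi>' l (\<Psi> m p)" using act_eq[OF f'] am by simp
  also have "\<dots> = \<Psi> (l * m) p"
    by (rule local_flow_compose[OF f(1,4,2,3) f'(1) _ f'(2)]) (use f'(3) am in simp)
  also have "\<dots> = act (l * m) p" by (rule act_eq[OF f(1,3,4), symmetric])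
  finally show ?thesis .
qed

section \<open>The action in charts and on parallel fields\<close>

lemma act_chart_open:
  assumes c: "c \<in> A" "c' \<in> A"
  defines "S \<equiv> {(l, x). x \<in> snd c ` fst c \<and> (l, chart_inv c x) \<in> W \<and> act l (chart_inv c x) \<in> fst c'}"
  shows "open S" and "continuous_on S (\<lambda>(l, x). snd c' (act l (chart_inv c x)))"
proof -
  let ?R = "UNIV \<times> snd c ` fst c :: (complex \<times> (complex^'n)) set"
  let ?g = "\<lambda>z. (fst z, chart_inv c (snd z))" and ?a = "\<lambda>(l, p). act l p"
  have g: "continuous_on ?R ?g"
    by (intro continuous_on_Pair continuous_on_fst continuous_on_id
        continuous_on_compose2[OF chart_inv_continuous[OF c(1)] continuous_on_snd[OF continuous_on_id]]) auto
  have R: "open ?R" by (intro open_Times open_UNIV open_ran c)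
  have T: "open (?R \<inter> ?g -` W)" by (rule continuous_open_preimage[OF g R open_W])
  have ag: "continuous_on (?R \<inter> ?g -` W) (\<lambda>z. ?a (?g z))"
    by (rule continuous_on_compose2[OF act_continuous continuous_on_subset[OF g]]) auto
  have eq: "S = (?R \<inter> ?g -` W) \<inter> (\<lambda>z. ?a (?g z)) -` fst c'" unfolding S_def by auto
  show "open S" unfolding eq by (rule continuous_open_preimage[OF ag T open_dom[OF c(2)]])
  have "continuous_on S (\<lambda>z. snd c' (?a (?g z)))"
    by (rule continuous_on_compose2[OF chart_continuous[OF c(2)] continuous_on_subset[OF ag]])
      (auto simp: eq)
  then show "continuous_on S (\<lambda>(l, x). snd c' (act l (chart_inv c x)))"
    by (simp add: case_prod_unfold)
qed

text \<open>In charts the action is a continuous lift of scalar multiplication through the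
  immersion, hence differentiable jointly in scalar and point. The product rule then describes
  \<open>L\<close> after the differential at \<open>act l p\<close>, which determines
  \<open>L\<close> since that differential is injective.\<close>

lemma act_has_derivative:
  assumes c: "c \<in> A" "c' \<in> A" and W: "(l, p) \<in> W" and p: "p \<in> fst c" and q: "act l p \<in> fst c'"
  obtains L where
    "((\<lambda>(l, x). snd c' (act l (chart_inv c x))) has_derivative L) (at (l, snd c p))"
    "\<And>s v. diff_in c' \<phi> (act l p) (L (s, v)) = scale_V l (diff_in c \<phi> p v) + scale_V s (\<phi> p)"
proof -
  let ?S = "{(l, x). x \<in> snd c ` fst c \<and> (l, chart_inv c x) \<in> W \<and> act l (chart_inv c x) \<in> fst c'}"
  let ?h = "\<lambda>(l, x). snd c' (act l (chart_inv c x))"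
  let ?G = "\<phi> \<circ> chart_inv c'" and ?G' = "diff_in c' \<phi> (act l p)"
  let ?K = "\<lambda>z. scale_V (fst z) (\<phi> (chart_inv c (snd z)))"
  let ?K' = "\<lambda>z. scale_V l (diff_in c \<phi> p (snd z)) + scale_V (fst z) (\<phi> p)"
  have z: "(l, snd c p) \<in> ?S" using c W p q by simp
  note S = act_chart_open[OF c]
  have h: "?h (l, snd c p) = snd c' (act l p)" using c p by simp
  have G: "(?G has_derivative ?G') (at (?h (l, snd c p)))"
    unfolding h by (rule phi_has_derivative(1)[OF c(2) q])
  have "((\<lambda>z. (\<phi> \<circ> chart_inv c) (snd z)) has_derivative (\<lambda>z. diff_in c \<phi> p (snd z))) (at (l, snd c p))"
    by (rule has_derivative_compose[OF has_derivative_snd[OF has_derivative_ident]])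
      (use phi_has_derivative(1)[OF c(1) p] in \<open>simp add: o_def\<close>)
  from bounded_bilinear.FDERIV[OF bilinear_scale_V has_derivative_fst[OF has_derivative_ident] this]
  have K: "(?K has_derivative ?K') (at (l, snd c p))" using c p by simp
  have eq: "?G (?h z) = ?K z" if "z \<in> ?S" for z
    using that c(2) phi_act by (auto simp: case_prod_unfold)
  have "?h differentiable (at (l, snd c p))"
  proof (rule has_derivative_lift_inj[where G = ?G and K = ?K])
    show "(?G has_derivative ?G') (at (?h (l, snd c p)))" by (rule G)
    show "inj ?G'" by (rule injI, rule re_part_diff_phi_inj[OF c(2) q]) (simp only:)
    show "?K differentiable (at (l, snd c p))" using K by (auto simp: differentiable_def)
    show "isCont ?h (l, snd c p)"
      by (rule bspec[OF S(2)[unfolded continuous_on_eq_continuous_at[OF S(1)]] z])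
    have "\<forall>\<^sub>F y in nhds (l, snd c p). y \<in> ?S" using S(1) z by (rule eventually_nhds_in_open)
    then show "\<forall>\<^sub>F y in nhds (l, snd c p). ?G (?h y) = ?K y" by eventually_elim (rule eq)
  qed
  then obtain L where L: "(?h has_derivative L) (at (l, snd c p))" by (auto simp: differentiable_def)
  have "((\<lambda>z. ?G (?h z)) has_derivative (\<lambda>v. ?G' (L v))) (at (l, snd c p))"
    by (rule has_derivative_compose[OF L G])
  then have "(?K has_derivative (\<lambda>v. ?G' (L v))) (at (l, snd c p))"
    by (rule has_derivative_transform_within_open[OF _ S(1) z eq])
  from has_derivative_unique[OF this K] have "?G' (L z) = ?K' z" for z by (rule fun_cong)
  then show thesis by (intro that[OF L]) simp
qed

lemma local_holomorphic_action_act: "local_holomorphic_action A W act"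
  unfolding local_holomorphic_action_def
proof (intro conjI ballI allI impI open_W act_continuous act_one)
  show "W \<subseteq> (- {0}) \<times> UNIV" using W_nonzero by auto
  show "{1} \<times> UNIV \<subseteq> W" using one_W by auto
  show "act l (act m p) = act (l * m) p" if "(m, p) \<in> W \<and> (l, act m p) \<in> W \<and> (l * m, p) \<in> W" for l m p
    using that by (intro act_act) simp_all
next
  fix c c' assume c: "c \<in> A" "c' \<in> A"
  show "holomorphic_wrt J_prod J_vec
      {(l, x). x \<in> snd c ` fst c \<and> (l, chart_inv c x) \<in> W \<and> act l (chart_inv c x) \<in> fst c'}
      (\<lambda>(l, x). snd c' (act l (chart_inv c x)))"
    unfolding holomorphic_wrt_def
  proof (intro conjI ballI act_chart_open[OF c])
    fix z assume "z \<in> {(l, x). x \<in> snd c ` fst c \<and> (l, chart_inv c x) \<in> W \<and> act l (chart_inv c x) \<in> fst c'}"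
    then obtain l p where z: "z = (l, snd c p)" and p: "p \<in> fst c" "(l, p) \<in> W" "act l p \<in> fst c'"
      using c by auto
    obtain L where L: "((\<lambda>(l, x). snd c' (act l (chart_inv c x))) has_derivative L) (at (l, snd c p))"
      "\<And>s v. diff_in c' \<phi> (act l p) (L (s, v)) = scale_V l (diff_in c \<phi> p v) + scale_V s (\<phi> p)"
      by (rule act_has_derivative[OF c p(2,1,3)]) (rule that)
    have "L (J_prod v) = J_vec (L v)" for v
    proof -
      obtain s u where v: "v = (s, u)" by (cases v)
      \<comment> \<open>The formula for the composite with \<open>L\<close> is complex linear in
        \<open>(s, u)\<close>, and the differential of \<open>\<phi>\<close> is complex linear and
        injective; so \<open>L\<close> commutes with the complex structures.\<close>
      have "diff_in c' \<phi> (act l p) (L (J_prod v)) = diff_in c' \<phi> (act l p) (J_vec (L v))"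
        unfolding phi_has_derivative(2)[OF c(2) p(3)] v
        by (simp add: J_prod_def L(2) diff_phi_scale[OF c(1) p(1)] scale_V_simps(1,4) mult.commute)
      then show ?thesis by (intro re_part_diff_phi_inj[OF c(2) p(3)]) (simp only:)
    qed
    with L(1) show "\<exists>L. ((\<lambda>(l, x). snd c' (act l (chart_inv c x))) has_derivative L) (at z) \<and>
        (\<forall>v. L (J_prod v) = J_vec (L v))"
      unfolding z by blast
  qed
qed

lemma act_parallel:
  assumes c: "c \<in> A" "c' \<in> A" and W: "(l, p) \<in> W" and p: "p \<in> D \<inter> fst c" and q: "act l p \<in> D \<inter> fst c'"
    and D: "connected D" and X: "parallel_field A nabla D X"
  shows "diff_in c (snd c' \<circ> act l) p (X c p) = l *s X c' (act l p)"
proof -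
  have p': "p \<in> fst c" and q': "act l p \<in> fst c'" using p q by auto
  obtain L where L: "((\<lambda>(l, x). snd c' (act l (chart_inv c x))) has_derivative L) (at (l, snd c p))"
    "\<And>s v. diff_in c' \<phi> (act l p) (L (s, v)) = scale_V l (diff_in c \<phi> p v) + scale_V s (\<phi> p)"
    by (rule act_has_derivative[OF c W p' q']) (rule that)
  \<comment> \<open>The scalar is held fixed, so its increment in \<open>L\<close> is zero and the
    term with \<open>\<phi> p\<close> drops out.\<close>
  have "((\<lambda>x. (l, x)) has_derivative (\<lambda>v. (0, v))) (at (snd c p))"
    by (intro has_derivative_Pair has_derivative_const has_derivative_ident)
  from has_derivative_compose[OF this L(1)]
  have "(snd c' \<circ> act l \<circ> chart_inv c has_derivative (\<lambda>v. L (0, v))) (at (snd c p))"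
    by (simp add: o_def)
  then have "diff_in c (snd c' \<circ> act l) p = (\<lambda>v. L (0, v))"
    by (subst diff_in_def) (rule frechet_derivative_at[symmetric])
  then have Lv: "diff_in c' \<phi> (act l p) (diff_in c (snd c' \<circ> act l) p v) = scale_V l (diff_in c \<phi> p v)" for v
    using L(2)[of 0 v] scale_V_simps(7)[of 0 0 "\<phi> p"] by simp
  \<comment> \<open>\<open>?u\<close> is the transported vector divided by \<open>l\<close>. Its
    image under the differential at \<open>act l p\<close> is the image of \<open>X\<close> at
    \<open>p\<close>, whose real part is that of the image of \<open>X\<close> at
    \<open>act l p\<close>; so \<open>?u\<close> is the value of \<open>X\<close> there.\<close>
  let ?u = "(1 / l) *s diff_in c (snd c' \<circ> act l) p (X c p)"
  have "diff_in c' \<phi> (act l p) ?u = diff_in c \<phi> p (X c p)"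
    using W_nonzero[OF W] by (simp add: diff_phi_scale[OF c(2) q'] Lv scale_V_simps(1,2))
  moreover have "x_coord i (diff_in c \<phi> p (X c p)) = x_coord i (diff_in c' \<phi> (act l p) (X c' (act l p)))"
    "y_coord i (diff_in c \<phi> p (X c p)) = y_coord i (diff_in c' \<phi> (act l p) (X c' (act l p)))" for i
    using parallel_derivative_constant[OF X affine_coords(1)[of i] D c(1) p c(2) q]
      parallel_derivative_constant[OF X affine_coords(2)[of i] D c(1) p c(2) q]
    by (simp_all only: deriv_along_def diff_x_coord[OF c(1) p'] diff_y_coord[OF c(1) p']
        diff_x_coord[OF c(2) q'] diff_y_coord[OF c(2) q'])
  ultimately have "?u = X c' (act l p)"
    by (intro re_part_diff_phi_inj[OF c(2) q']) (simp add: re_part_eq_iff)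
  then have "l *s X c' (act l p) = l *s ?u" by simp
  also have "\<dots> = diff_in c (snd c' \<circ> act l) p (X c p)"
    using W_nonzero[OF W] by (simp add: vector_smult_assoc)
  finally show ?thesis by simp
qed

lemma conic_action_act: "conic_action A nabla W act"
  unfolding conic_action_def Let_def
proof (intro allI impI ballI)
  fix r \<theta> :: real and B D X c c' p
  let ?l = "of_real r * cis \<theta>"
  assume *: "0 < r \<and> action_domain A W act ?l B \<and> connected D \<and> parallel_field A nabla D X"
    and c: "c \<in> A" "c' \<in> A" and p: "p \<in> B \<inter> D \<inter> fst c" and q: "act ?l p \<in> D \<inter> fst c'"
  have "(?l, p) \<in> W" using * p unfolding action_domain_def by blast
  then have "diff_in c (snd c' \<circ> act ?l) p (X c p) = ?l *s X c' (act ?l p)"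
    using c * p q by (intro act_parallel[where D = D]) auto
  also have "\<dots> = (r * cos \<theta>) *\<^sub>R X c' (act ?l p) + (r * sin \<theta>) *\<^sub>R J_vec (X c' (act ?l p))"
    by (auto simp: J_vec_def vec_eq_iff complex_eq_iff algebra_simps)
  finally show "diff_in c (snd c' \<circ> act ?l) p (X c p) =
      (r * cos \<theta>) *\<^sub>R X c' (act ?l p) + (r * sin \<theta>) *\<^sub>R J_vec (X c' (act ?l p))" .
qed

lemma conic_symplectic: "conic_symplectic_structure A nabla (induced_form \<phi>) W act"
  using induced atlas local_holomorphic_action_act conic_action_act symplectic_induced_form parallel_induced_form
  unfolding conic_symplectic_structure_def conic_complex_structure_def induced_connection_def by blast

section \<open>Conic real special coordinates\<close>

lemma real_coordinates_F:
  assumes D: "open D" "open (F ` D)" and homeo: "homeomorphism D (F ` D) F (inv_into D F)"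
  shows "real_coordinates A D F"
  unfolding real_coordinates_def smooth_fun_def
proof (intro conjI ballI D homeo)
  fix c assume c: "c \<in> A"
  show "smooth_on (snd c ` (D \<inter> fst c)) (F \<circ> chart_inv c)"
    by (rule smooth_on_subset[OF smooth_F[OF c] open_chart_image[OF c D(1)]]) auto
  let ?S = "F ` (D \<inter> fst c)"
  have inv: "inv_into D F (F p) = p" if "p \<in> D" for p using homeo that by (rule homeomorphism_apply1)
  have cont: "continuous_on (F ` D) (inv_into D F)" using homeo by (simp add: homeomorphism_def)
  have "?S = F ` D \<inter> inv_into D F -` fst c" using inv by auto
  then have S: "open ?S" using continuous_open_preimage[OF cont D(2) open_dom[OF c]] by simp
  show "smooth_on ?S (snd c \<circ> inv_into D F)"
  \<comment> \<open>The inverse coordinates are a continuous lift of the identity through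
    \<open>F\<close> read in the chart \<open>c\<close>.\<close>
  proof (rule smooth_on_lift[OF smooth_F[OF c] inj_derivative_F[OF c] _ _ smooth_on_ident[OF S]])
    show "continuous_on ?S (snd c \<circ> inv_into D F)"
      by (rule continuous_on_compose[OF continuous_on_subset[OF cont] continuous_on_subset[OF chart_continuous[OF c]]])
        (use inv in auto)
    show "(snd c \<circ> inv_into D F) ` ?S \<subseteq> snd c ` fst c" using inv by auto
    show "(F \<circ> chart_inv c) ((snd c \<circ> inv_into D F) y) = y" if "y \<in> ?S" for y
      using that inv c by auto
  qed
qed

text \<open>The components of \<open>\<phi>\<close> itself serve as the holomorphic functions with
  the given real parts, and their homogeneity is the lifting property
  \<open>phi_act\<close>.\<close>

lemma conic_coordinates:
  obtains D where "p \<in> D" "conic_real_special_coordinates A nabla (induced_form \<phi>) W act D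
    (\<lambda>i. x_coord i \<circ> \<phi>) (\<lambda>i. y_coord i \<circ> \<phi>)"
proof -
  obtain D where D: "open D" "p \<in> D" "open (F ` D)" "homeomorphism D (F ` D) F (inv_into D F)"
    by (rule F_local)
  have F: "(\<lambda>p. (\<chi> i. (x_coord i \<circ> \<phi>) p, \<chi> i. (y_coord i \<circ> \<phi>) p)) = F"
    by (simp add: fun_eq_iff F_def re_part_def)
  have "real_special_coordinates A nabla (induced_form \<phi>) D (\<lambda>i. x_coord i \<circ> \<phi>) (\<lambda>i. y_coord i \<circ> \<phi>)"
    unfolding real_special_coordinates_def F
    using real_coordinates_F[OF D(1,3,4)] affine_subset[OF affine_coords(1) D(1)]
      affine_subset[OF affine_coords(2) D(1)] induced_form_eq
    by simp
  moreover have "holomorphic_fun A D \<phi>"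
    unfolding holomorphic_fun_def holomorphic_wrt_def
  proof (intro conjI ballI D(1))
    fix c x assume c: "c \<in> A" and "x \<in> snd c ` (D \<inter> fst c)"
    then show "\<exists>L. (\<phi> \<circ> chart_inv c has_derivative L) (at x) \<and> (\<forall>v. L (J_vec v) = J_V (L v))"
      using phi_has_derivative[OF c] by blast
  qed (use open_chart_image D(1) in blast)
  moreover have "\<phi> (act l q) = scale_V l (\<phi> q)" if "action_domain A W act l B" "q \<in> B" for l B q
    using phi_act[of l q] that unfolding action_domain_def by blast
  ultimately have "conic_real_special_coordinates A nabla (induced_form \<phi>) W act D
    (\<lambda>i. x_coord i \<circ> \<phi>) (\<lambda>i. y_coord i \<circ> \<phi>)"
    unfolding conic_real_special_coordinates_def by (auto simp: x_coord_def y_coord_def)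
  with D(2) show thesis by (rule that)
qed

end

theorem theorem7:
  fixes A :: "('m::{t2_space, second_countable_topology}, 'n::finite) chart set"
    and \<phi> :: "'m \<Rightarrow> 'n cotangent"
    and nabla :: "('m, 'n) conn"
  assumes "complex_atlas A"
    and "totally_complex A \<phi>"
    and "conic_immersion \<phi>"
    and "induced_connection A \<phi> nabla"
  shows "conic_symplectic_manifold A nabla (induced_form \<phi>) \<and>
    (\<exists>W \<Phi>. conic_symplectic_structure A nabla (induced_form \<phi>) W \<Phi> \<and>
      (\<forall>p. \<exists>D. p \<in> D \<and>
         conic_real_special_coordinates A nabla (induced_form \<phi>) W \<Phi> D
           (\<lambda>i. x_coord i \<circ> \<phi>) (\<lambda>i. y_coord i \<circ> \<phi>)))"
proof -
  interpret conic_totally_complex A \<phi> nabla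
    using assms by unfold_locales
  have "conic_symplectic_manifold A nabla (induced_form \<phi>)"
    unfolding conic_symplectic_manifold_def by (intro exI) (rule conic_symplectic)
  moreover have "\<exists>D. p \<in> D \<and> conic_real_special_coordinates A nabla (induced_form \<phi>) W act D
      (\<lambda>i. x_coord i \<circ> \<phi>) (\<lambda>i. y_coord i \<circ> \<phi>)" for p
    by (rule conic_coordinates[of p]) (intro exI conjI)
  \<comment> \<open>One action witnesses both the conic structure and the homogeneity of the
    coordinates around every point.\<close>
  ultimately show ?thesis
    by (intro conjI exI[of _ W] exI[of _ act] allI conic_symplectic)
qed

end
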